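(* Let $\lambda=(\lambda_n)$ be any frequency. Then $\mathcal{D}_{\infty,+}(\lambda)$ is a nuclear Fréchet space if and only if $L(\lambda)=0$.
   Context: A frequency is a strictly increasing unbounded sequence $\lambda=(\lambda_n)_{n\ge 1}$ of non-negative real numbers, and \[ L(\lambda)=\limsup_{n\to\infty}\frac{\log n}{\lambda_n}\in[0,\infty]. \] A $\lambda$-Dirichlet series is a formal series $D=\sum a_n e^{-\lambda_n s}$ with $a_n\in\mathbb{C}$. Write $[\mathrm{Re}>\sigma]=\{s\in\mathbb{C}:\mathrm{Re}\,s>\sigma\}$. $\mathcal{D}_{\infty,+}(\lambda)$ is the space of all $\lambda$-Dirichlet series that converge on $[\mathrm{Re}>0]$ to a (necessarily holomorphic) function which is bounded on $[\mathrm{Re}>\sigma]$ for each $\sigma>0$, with the locally convex topology given by the increasing... i.e. monotone in $k$, sequence of norms $\|D\|_{k}=\sup_{\mathrm{Re}\,s>1/k}|D(s)|$, $k\in\mathbb{N}$. A Fréchet space is a complete Hausdorff locally convex space whose topology is given by countably many seminorms. A locally convex space $E$ with a directed family $\mathcal{P}$ of seminorms is nuclear if for every $q\in\mathcal{P}$ there are $p\in\mathcal{P}$ and $c>0$ with $q\le cp$ such that the canonical map $E/\ker p\to E/\ker q$ between the associated normed spaces is nuclear. Here an operator $u:X\to Y$ between normed spaces is nuclear if there are $(x_n^* )\subset X^*$ and $(y_n)\subset Y$ with $\sum_n\|x_n^*\|\,\|y_n\|<\infty$ and $u(x)=\sum_n x_n^*(x)y_n$ for all $x\in X$. *)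

theory Defs
  imports "HOL-Analysis.Analysis" "HOL-Algebra.AbelCoset" "HOL-Algebra.Module"
    "HOL-Decision_Procs.Algebra_Aux"
begin

section \<open>Complex vector spaces and seminorms\<close>

text \<open>Vector spaces carry an explicit carrier, so that the quotients \<open>E/ker p\<close>, whose elements
  are cosets, and the space of Dirichlet series are instances of the same notion.\<close>

abbreviation complex_vector_space :: "(complex, 'v) module \<Rightarrow> bool" where
  "complex_vector_space E \<equiv> Module.module (cring_class_ops :: complex ring) E"

definition seminorm :: "(complex, 'v) module \<Rightarrow> ('v \<Rightarrow> real) \<Rightarrow> bool" where
  "seminorm E p \<longleftrightarrow>
     (\<forall>x\<in>carrier E. 0 \<le> p x) \<and>
     (\<forall>x\<in>carrier E. \<forall>y\<in>carrier E. p (x \<oplus>\<^bsub>E\<^esub> y) \<le> p x + p y) \<and>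
     (\<forall>c. \<forall>x\<in>carrier E. p (c \<odot>\<^bsub>E\<^esub> x) = cmod c * p x)"

definition linear_map ::
    "(complex, 'v) module \<Rightarrow> (complex, 'w) module \<Rightarrow> ('v \<Rightarrow> 'w) \<Rightarrow> bool" where
  "linear_map E F u \<longleftrightarrow>
     u \<in> carrier E \<rightarrow> carrier F \<and>
     (\<forall>x\<in>carrier E. \<forall>y\<in>carrier E. u (x \<oplus>\<^bsub>E\<^esub> y) = u x \<oplus>\<^bsub>F\<^esub> u y) \<and>
     (\<forall>c. \<forall>x\<in>carrier E. u (c \<odot>\<^bsub>E\<^esub> x) = c \<odot>\<^bsub>F\<^esub> u x)"


section \<open>Nuclear operators between normed spaces\<close>

text \<open>A normed space is given by a vector space \<open>X\<close> together with a norm \<open>N\<close> on its carrier.\<close>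

definition dual_space :: "(complex, 'v) module \<Rightarrow> ('v \<Rightarrow> real) \<Rightarrow> ('v \<Rightarrow> complex) set" where
  "dual_space X N =
     {f. (\<forall>x\<in>carrier X. \<forall>y\<in>carrier X. f (x \<oplus>\<^bsub>X\<^esub> y) = f x + f y) \<and>
         (\<forall>c. \<forall>x\<in>carrier X. f (c \<odot>\<^bsub>X\<^esub> x) = c * f x) \<and>
         (\<exists>C. \<forall>x\<in>carrier X. cmod (f x) \<le> C * N x)}"

definition dual_norm ::
    "(complex, 'v) module \<Rightarrow> ('v \<Rightarrow> real) \<Rightarrow> ('v \<Rightarrow> complex) \<Rightarrow> real" where
  "dual_norm X N f = (SUP x\<in>{x \<in> carrier X. N x \<le> 1}. cmod (f x))"

definition nuclear_operator ::
    "(complex, 'v) module \<Rightarrow> ('v \<Rightarrow> real) \<Rightarrow> (complex, 'w) module \<Rightarrow> ('w \<Rightarrow> real) \<Rightarrow>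
     ('v \<Rightarrow> 'w) \<Rightarrow> bool" where
  "nuclear_operator X N Y N' u \<longleftrightarrow>
     linear_map X Y u \<and>
     (\<exists>(f :: nat \<Rightarrow> 'v \<Rightarrow> complex) (y :: nat \<Rightarrow> 'w).
        (\<forall>n. f n \<in> dual_space X N) \<and> (\<forall>n. y n \<in> carrier Y) \<and>
        summable (\<lambda>n. dual_norm X N (f n) * N' (y n)) \<and>
        (\<forall>x\<in>carrier X.
           (\<lambda>m. N' (u x \<ominus>\<^bsub>Y\<^esub> (\<Oplus>\<^bsub>Y\<^esub>n\<in>{..<m}. f n x \<odot>\<^bsub>Y\<^esub> y n))) \<longlonglongrightarrow> 0))"


section \<open>The normed spaces associated with seminorms\<close>

definition seminorm_kernel :: "(complex, 'v) module \<Rightarrow> ('v \<Rightarrow> real) \<Rightarrow> 'v set" where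
  "seminorm_kernel E p = {x \<in> carrier E. p x = 0}"

text \<open>The fields \<open>mult\<close> and \<open>one\<close> of a module record play no role.\<close>

definition quotient_space ::
    "(complex, 'v) module \<Rightarrow> 'v set \<Rightarrow> (complex, 'v set) module" where
  "quotient_space E W =
     \<lparr>carrier = a_rcosets\<^bsub>E\<^esub> W, mult = undefined, one = undefined,
      zero = W, add = set_add E,
      smult = (\<lambda>c A. W <+>\<^bsub>E\<^esub> ((\<lambda>x. c \<odot>\<^bsub>E\<^esub> x) ` A))\<rparr>"

definition local_space ::
    "(complex, 'v) module \<Rightarrow> ('v \<Rightarrow> real) \<Rightarrow> (complex, 'v set) module" where
  "local_space E p = quotient_space E (seminorm_kernel E p)"

definition local_norm :: "('v \<Rightarrow> real) \<Rightarrow> 'v set \<Rightarrow> real" where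
  "local_norm p A = (THE r. \<forall>x\<in>A. p x = r)"

text \<open>If \<open>ker p \<subseteq> ker q\<close>, this maps the coset \<open>x + ker p\<close> to \<open>x + ker q\<close>.\<close>

definition canonical_map ::
    "(complex, 'v) module \<Rightarrow> ('v \<Rightarrow> real) \<Rightarrow> 'v set \<Rightarrow> 'v set" where
  "canonical_map E q A = seminorm_kernel E q <+>\<^bsub>E\<^esub> A"


section \<open>Locally convex spaces\<close>

text \<open>The balls form a subbase of the locally convex topology; the carrier is added only so that
  it is the whole space also for an empty family.\<close>

definition lc_topology :: "(complex, 'v) module \<Rightarrow> ('v \<Rightarrow> real) set \<Rightarrow> 'v topology" where
  "lc_topology E P = topology_generated_by
     (insert (carrier E)
        {{y \<in> carrier E. p (y \<ominus>\<^bsub>E\<^esub> x) < e} |p x e. p \<in> P \<and> x \<in> carrier E \<and> 0 < e})"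

text \<open>Completeness refers to the translation-invariant uniformity of a vector topology. Filters
  are used so that the notion makes sense without any countability assumption.\<close>

definition cauchy_filter_on ::
    "(complex, 'v) module \<Rightarrow> 'v topology \<Rightarrow> 'v filter \<Rightarrow> bool" where
  "cauchy_filter_on E T F \<longleftrightarrow>
     F \<noteq> bot \<and> (\<forall>\<^sub>F x in F. x \<in> carrier E) \<and>
     (\<forall>U. openin T U \<and> \<zero>\<^bsub>E\<^esub> \<in> U \<longrightarrow> (\<forall>\<^sub>F (x, y) in F \<times>\<^sub>F F. x \<ominus>\<^bsub>E\<^esub> y \<in> U))"

definition complete_space_on :: "(complex, 'v) module \<Rightarrow> 'v topology \<Rightarrow> bool" where
  "complete_space_on E T \<longleftrightarrow>
     (\<forall>F. cauchy_filter_on E T F \<longrightarrow> (\<exists>l. limitin T (\<lambda>x. x) l F))"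

definition frechet_space :: "(complex, 'v) module \<Rightarrow> 'v topology \<Rightarrow> bool" where
  "frechet_space E T \<longleftrightarrow>
     complex_vector_space E \<and>
     (\<exists>P. countable P \<and> (\<forall>p\<in>P. seminorm E p) \<and> T = lc_topology E P) \<and>
     Hausdorff_space T \<and> complete_space_on E T"

definition directed_seminorms :: "(complex, 'v) module \<Rightarrow> ('v \<Rightarrow> real) set \<Rightarrow> bool" where
  "directed_seminorms E P \<longleftrightarrow>
     P \<noteq> {} \<and> (\<forall>p\<in>P. seminorm E p) \<and>
     (\<forall>p\<in>P. \<forall>q\<in>P. \<exists>r\<in>P. \<forall>x\<in>carrier E. p x \<le> r x \<and> q x \<le> r x)"

definition nuclear_space :: "(complex, 'v) module \<Rightarrow> ('v \<Rightarrow> real) set \<Rightarrow> bool" where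
  "nuclear_space E P \<longleftrightarrow>
     complex_vector_space E \<and> directed_seminorms E P \<and>
     (\<forall>q\<in>P. \<exists>p\<in>P. \<exists>c>0.
        (\<forall>x\<in>carrier E. q x \<le> c * p x) \<and>
        nuclear_operator (local_space E p) (local_norm p) (local_space E q) (local_norm q)
          (canonical_map E q))"


section \<open>General Dirichlet series\<close>

text \<open>Sequences are indexed from 0: \<open>\<lambda> n\<close> and \<open>a n\<close> stand for the mathematical
  \<open>\<lambda>\<^sub>n\<^sub>+\<^sub>1\<close> and \<open>a\<^sub>n\<^sub>+\<^sub>1\<close>. A formal Dirichlet series is its sequence of coefficients.\<close>

definition frequency :: "(nat \<Rightarrow> real) \<Rightarrow> bool" where
  "frequency lam \<longleftrightarrow> strict_mono lam \<and> (\<forall>n. 0 \<le> lam n) \<and> \<not> bdd_above (range lam)"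

definition L_freq :: "(nat \<Rightarrow> real) \<Rightarrow> ereal" where
  "L_freq lam = limsup (\<lambda>n. ereal (ln (real (n + 1)) / lam n))"

definition dirichlet_term :: "(nat \<Rightarrow> real) \<Rightarrow> (nat \<Rightarrow> complex) \<Rightarrow> complex \<Rightarrow> nat \<Rightarrow> complex" where
  "dirichlet_term lam a s n = a n * exp (- of_real (lam n) * s)"

definition dirichlet_fun :: "(nat \<Rightarrow> real) \<Rightarrow> (nat \<Rightarrow> complex) \<Rightarrow> complex \<Rightarrow> complex" where
  "dirichlet_fun lam a s = (\<Sum>n. dirichlet_term lam a s n)"

definition D_infty_plus :: "(nat \<Rightarrow> real) \<Rightarrow> (complex, nat \<Rightarrow> complex) module" where
  "D_infty_plus lam =
     \<lparr>carrier = {a. (\<forall>s. 0 < Re s \<longrightarrow> summable (dirichlet_term lam a s)) \<and>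
                    (\<forall>\<sigma>>0. bounded (dirichlet_fun lam a ` {s. \<sigma> < Re s}))},
      mult = undefined, one = undefined,
      zero = (\<lambda>n. 0), add = (\<lambda>a b n. a n + b n), smult = (\<lambda>c a n. c * a n)\<rparr>"

definition D_norm :: "(nat \<Rightarrow> real) \<Rightarrow> nat \<Rightarrow> (nat \<Rightarrow> complex) \<Rightarrow> real" where
  "D_norm lam k a = (SUP s\<in>{s. 1 / real k < Re s}. cmod (dirichlet_fun lam a s))"

definition D_norms :: "(nat \<Rightarrow> real) \<Rightarrow> ((nat \<Rightarrow> complex) \<Rightarrow> real) set" where
  "D_norms lam = {D_norm lam k |k. 1 \<le> k}"

end

theory Submission
  imports Defs "HOL-Complex_Analysis.Complex_Analysis"
begin

text \<open>
  Write \<open>e\<^sub>n\<close> for the Dirichlet monomial \<open>exp (-\<lambda>\<^sub>n s)\<close> and \<open>D\<close> for a series with coefficients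
  \<open>a\<^sub>n\<close>.

  If the space is nuclear, then for each \<open>m\<close> the identity is a nuclear operator from some norm
  \<open>\<parallel>\<cdot>\<parallel>\<^sub>k\<close> to \<open>\<parallel>\<cdot>\<parallel>\<^sub>m\<close>, say \<open>x = \<Sum>\<^sub>j g\<^sub>j(x) z\<^sub>j\<close>. The proof computes the trace of this representation
  against a diagonal operator of finite rank that maps back from \<open>\<parallel>\<cdot>\<parallel>\<^sub>m\<close> to \<open>\<parallel>\<cdot>\<parallel>\<^sub>k\<close>. Plain partial sums
  would not do, since for a general frequency they need not be uniformly bounded. The second
  Riesz means, with weights \<open>w\<^sub>n = max(0, 1 - \<lambda>\<^sub>n/X)\<^sup>2\<close>, are bounded uniformly in \<open>X\<close>: Perron's formula
  writes them as an average of vertical translates of \<open>D\<close> against an integrable kernel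
  (\<open>riesz_mean_bound\<close>). Composing with the translation \<open>s \<mapsto> s + 1/m\<close> gives the operator
  \<open>e\<^sub>n \<mapsto> w\<^sub>n exp(-\<lambda>\<^sub>n/m) e\<^sub>n\<close>, whose norm from \<open>\<parallel>\<cdot>\<parallel>\<^sub>m\<close> to any \<open>\<parallel>\<cdot>\<parallel>\<^sub>k\<close> is at most \<open>exp 1\<close>. Comparing traces,
  \<open>\<Sum>\<^sub>n w\<^sub>n exp(-\<lambda>\<^sub>n/m) \<le> exp 1 * \<Sum>\<^sub>j \<parallel>g\<^sub>j\<parallel> \<parallel>z\<^sub>j\<parallel>\<^sub>m\<close>. Letting \<open>X\<close> grow, \<open>\<Sum>\<^sub>n exp(-\<lambda>\<^sub>n/m)\<close> converges, so that
  \<open>n exp(-\<lambda>\<^sub>n/m)\<close> is bounded and \<open>L(\<lambda>) \<le> 1/m\<close>.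

  Conversely, if \<open>L(\<lambda>) = 0\<close>, then \<open>\<Sum>\<^sub>n exp(-\<sigma>\<lambda>\<^sub>n)\<close> converges for every \<open>\<sigma> > 0\<close>, every series in the space
  converges absolutely in the open right half-plane, and \<open>|a\<^sub>n| \<le> exp(\<sigma>\<lambda>\<^sub>n) \<parallel>D\<parallel>\<^sub>k\<close> for \<open>\<sigma> > 1/k\<close>
  (\<open>cauchy_coefficient_bound\<close>). The space is therefore a Koethe sequence space, and
  \<open>D = \<Sum>\<^sub>n a\<^sub>n e\<^sub>n\<close> is itself a nuclear representation of the identity. Completeness follows from
  convergence of the coefficients, controlled by the same two estimates.
\<close>

section \<open>A contour integral: the kernel of the Riesz means\<close>

lemma lebesgue_integral_inverse_one_plus_square:
  "integrable lborel (\<lambda>u::real. 1 / (1 + u\<^sup>2))"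
  "(LBINT u::real. 1 / (1 + u\<^sup>2)) = pi"
proof -
  have pos: "1 + x\<^sup>2 \<noteq> 0" for x :: real
    by (smt (verit) zero_le_power2)
  have *: "DERIV arctan x :> 1 / (1 + x\<^sup>2)"
    "isCont (\<lambda>u. 1 / (1 + u\<^sup>2)) x" "0 \<le> 1 / (1 + x\<^sup>2)" for x :: real
    by (auto intro!: derivative_eq_intros continuous_intros simp: field_simps pos)
  have lim: "((arctan \<circ> real_of_ereal) \<longlongrightarrow> - (pi / 2)) (at_right (- \<infinity>))"
    "((arctan \<circ> real_of_ereal) \<longlongrightarrow> pi / 2) (at_left \<infinity>)"
    by (simp_all add: ereal_tendsto_simps tendsto_arctan_at_bot tendsto_arctan_at_top)
  have "set_integrable lborel (einterval (-\<infinity>) \<infinity>) (\<lambda>u::real. 1 / (1 + u\<^sup>2))"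
    by (rule interval_integral_FTC_nonneg(1)[OF _ *(1,2) _ lim]) (simp_all add: *(3))
  then show "integrable lborel (\<lambda>u::real. 1 / (1 + u\<^sup>2))"
    by (simp add: set_integrable_def)
  have "(LBINT u=-\<infinity>..\<infinity>. 1 / (1 + u\<^sup>2)) = pi / 2 - - (pi / 2)"
    by (rule interval_integral_FTC_nonneg(2)[OF _ *(1,2) _ lim]) (simp_all add: *(3))
  then show "(LBINT u::real. 1 / (1 + u\<^sup>2)) = pi"
    by (simp add: interval_lebesgue_integral_def set_lebesgue_integral_def)
qed

lemmas integrable_inverse_one_plus_square = lebesgue_integral_inverse_one_plus_square(1)

text \<open>The integrand \<open>exp(yz)/z\<^sup>3\<close> of Perron's formula on the line \<open>Re z = 1\<close>. The third power, and
  not the second, is needed because partial sums of a conditionally convergent Dirichlet series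
  may grow linearly along vertical lines, and the product must still be integrable.\<close>
definition riesz_kernel :: "real \<Rightarrow> real \<Rightarrow> complex" where
  "riesz_kernel y u = exp (of_real y * Complex 1 u) / Complex 1 u ^ 3"

lemma norm_riesz_kernel:
  "cmod (riesz_kernel y u) = exp y / sqrt (1 + u\<^sup>2) ^ 3"
  by (simp add: riesz_kernel_def norm_divide norm_power complex_norm)

lemma one_le_norm_Complex_1: "1 \<le> cmod (Complex 1 u)"
  by (simp add: complex_norm)

lemma norm_Complex_1_times_riesz_kernel:
  "cmod (Complex 1 u) * cmod (riesz_kernel y u) = exp y / (1 + u\<^sup>2)"
proof -
  have "0 < 1 + u\<^sup>2" by (smt (verit) zero_le_power2)
  then show ?thesis
    by (simp add: norm_riesz_kernel complex_norm power3_eq_cube)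
qed

lemma norm_riesz_kernel_le: "cmod (riesz_kernel y u) \<le> exp y / (1 + u\<^sup>2)"
  using mult_right_mono[OF one_le_norm_Complex_1[of u], of "cmod (riesz_kernel y u)"]
  by (simp add: norm_Complex_1_times_riesz_kernel)

lemma Complex_1_nonzero: "Complex 1 u \<noteq> 0"
  by (simp add: complex_eq_iff)

lemma continuous_on_riesz_kernel: "continuous_on A (riesz_kernel y)"
proof -
  have "continuous_on A (\<lambda>u. Complex 1 u)"
    unfolding Complex_eq by (intro continuous_intros)
  then show ?thesis
    unfolding riesz_kernel_def by (intro continuous_intros) (auto simp: Complex_1_nonzero)
qed

lemma borel_measurable_riesz_kernel [measurable]: "riesz_kernel y \<in> borel_measurable borel"
  by (rule borel_measurable_continuous_onI[OF continuous_on_riesz_kernel])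

lemma integrable_riesz_kernel: "integrable lborel (riesz_kernel y)"
proof (rule Bochner_Integration.integrable_bound)
  show "integrable lborel (\<lambda>u. exp y * (1 / (1 + u\<^sup>2)))"
    by (intro integrable_mult_right integrable_inverse_one_plus_square)
  show "AE u in lborel. cmod (riesz_kernel y u) \<le> norm (exp y * (1 / (1 + u\<^sup>2)))"
  proof (intro AE_I2)
    fix u :: real
    have "0 \<le> 1 + u\<^sup>2" by simp
    then show "cmod (riesz_kernel y u) \<le> norm (exp y * (1 / (1 + u\<^sup>2)))"
      using norm_riesz_kernel_le[of y u] by simp
  qed
qed simp

lemma has_contour_integral_vertical_segment:
  assumes "0 < R"
  shows "((\<lambda>z. exp (of_real y * z) / z ^ 3) has_contour_integral
            \<i> * integral {-R..R} (riesz_kernel y)) (linepath (Complex 1 (-R)) (Complex 1 R))"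
proof -
  have "(riesz_kernel y has_integral integral {-R..R} (riesz_kernel y)) {-R..R}"
    by (intro integrable_integral integrable_continuous_real continuous_on_riesz_kernel)
  with assms show ?thesis
    by (subst has_contour_integral_linepath_same_Re_iff[where c=1 and a="-R" and b=R])
       (simp_all add: riesz_kernel_def[abs_def] flip: mult.assoc)
qed

text \<open>On the arcs used below \<open>y Re z\<close> stays bounded, so the cubic decay of the integrand beats the
  length of the arc as \<open>R\<close> grows.\<close>
lemma circle_arc_bound:
  fixes s t y R :: real
  assumes "1 < R" "s \<le> t" "t - s \<le> pi"
    and "\<And>z. z \<in> path_image (part_circlepath 1 R s t) \<Longrightarrow> y * Re z \<le> \<bar>y\<bar>"
  shows "cmod (contour_integral (part_circlepath 1 R s t) (\<lambda>z. exp (of_real y * z) / z ^ 3))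
           \<le> exp \<bar>y\<bar> / (R - 1) ^ 3 * R * pi"
proof -
  have big: "R - 1 \<le> cmod z" if "z \<in> path_image (part_circlepath 1 R s t)" for z
  proof -
    have "cmod (z - 1) = R"
      using that in_path_image_part_circlepath[of z 1 R s t] assms by simp
    moreover have "cmod (z - 1) \<le> cmod z + 1"
      using norm_triangle_ineq4[of z 1] by simp
    ultimately show ?thesis by simp
  qed
  have int: "(\<lambda>z. exp (of_real y * z) / z ^ 3) contour_integrable_on part_circlepath 1 R s t"
    using big assms(1)
    by (intro contour_integrable_continuous_part_circlepath continuous_intros) force
  have "cmod (contour_integral (part_circlepath 1 R s t) (\<lambda>z. exp (of_real y * z) / z ^ 3))
          \<le> exp \<bar>y\<bar> / (R - 1) ^ 3 * R * \<bar>t - s\<bar>"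
  proof (rule contour_integral_bound_part_circlepath[OF int])
    fix z assume z: "z \<in> path_image (part_circlepath 1 R s t)"
    have "cmod (exp (of_real y * z) / z ^ 3) = exp (y * Re z) / cmod z ^ 3"
      by (simp add: norm_divide norm_power)
    also have "\<dots> \<le> exp \<bar>y\<bar> / (R - 1) ^ 3"
      using assms(1,4) big z by (intro frac_le power_mono) auto
    finally show "cmod (exp (of_real y * z) / z ^ 3) \<le> exp \<bar>y\<bar> / (R - 1) ^ 3" .
  qed (use assms in auto)
  also have "\<dots> \<le> exp \<bar>y\<bar> / (R - 1) ^ 3 * R * pi"
    using assms by (intro mult_left_mono) auto
  finally show ?thesis .
qed

lemma path_image_right_arc:
  assumes "z \<in> path_image (part_circlepath 1 R (-pi/2) (pi/2))" "0 < R"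
  shows "1 \<le> Re z"
  using assms by (auto simp: path_image_part_circlepath cis.sel Re_exp intro!: mult_nonneg_nonneg cos_ge_zero)

lemma path_image_left_arc:
  assumes "z \<in> path_image (part_circlepath 1 R (pi/2) (3*pi/2))" "0 < R"
  shows "Re z \<le> 1"
proof -
  obtain x where x: "z = 1 + of_real R * exp (\<i> * of_real x)" "pi/2 \<le> x" "x \<le> 3*pi/2"
    using assms(1) by (auto simp: path_image_part_circlepath)
  have "cos x = - cos (x - pi)" by simp
  moreover have "0 \<le> cos (x - pi)" using x by (intro cos_ge_zero) auto
  ultimately have "cos x \<le> 0" by simp
  then show ?thesis using assms(2) x(1) by (simp add: Re_exp mult_nonneg_nonpos)
qed

lemma right_arc_bound:
  fixes y R :: real
  assumes R: "1 < R" and y: "y \<le> 0"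
  shows "cmod (contour_integral (part_circlepath 1 R (-pi/2) (pi/2)) (\<lambda>z. exp (of_real y * z) / z ^ 3))
           \<le> exp \<bar>y\<bar> / (R - 1) ^ 3 * R * pi"
proof (rule circle_arc_bound[OF R])
  fix z assume z: "z \<in> path_image (part_circlepath 1 R (-pi/2) (pi/2))"
  have "0 < R" using R by simp
  have "0 \<le> Re z" using path_image_right_arc[OF z \<open>0 < R\<close>] by (rule order_trans[OF zero_le_one])
  then have "y * Re z \<le> 0" by (rule mult_nonpos_nonneg[OF y])
  then show "y * Re z \<le> \<bar>y\<bar>" by (rule order_trans) (rule abs_ge_zero)
qed simp_all

lemma left_arc_bound:
  fixes y R :: real
  assumes R: "1 < R" and y: "0 \<le> y"
  shows "cmod (contour_integral (part_circlepath 1 R (pi/2) (3*pi/2)) (\<lambda>z. exp (of_real y * z) / z ^ 3))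
           \<le> exp \<bar>y\<bar> / (R - 1) ^ 3 * R * pi"
proof (rule circle_arc_bound[OF R])
  fix z assume z: "z \<in> path_image (part_circlepath 1 R (pi/2) (3*pi/2))"
  have "0 < R" using R by simp
  have "y * Re z \<le> y * 1" using path_image_left_arc[OF z \<open>0 < R\<close>] by (rule mult_left_mono[OF _ y])
  then show "y * Re z \<le> \<bar>y\<bar>" using y by simp
qed simp_all

text \<open>The integrand is holomorphic in the right half-plane, which contains the segment and the right
  half of the circle with centre 1 through its end points.\<close>
lemma vertical_segment_eq_right_arc:
  assumes R: "0 < R"
  shows "\<i> * integral {-R..R} (riesz_kernel y) =
    contour_integral (part_circlepath 1 R (-pi/2) (pi/2)) (\<lambda>z. exp (of_real y * z) / z ^ 3)"
proof -
  let ?f = "\<lambda>z::complex. exp (of_real y * z) / z ^ 3"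
  let ?L = "linepath (Complex 1 (-R)) (Complex 1 R)" and ?A = "part_circlepath 1 R (-pi/2) (pi/2)"
  let ?S = "{z. 0 < Re z}"
  have ends: "pathstart ?A = Complex 1 (-R)" "pathfinish ?A = Complex 1 R"
    by (auto simp: complex_eq_iff Re_exp Im_exp)
  have hol: "?f holomorphic_on ?S"
    by (intro holomorphic_intros) auto
  have L: "path_image ?L \<subseteq> ?S"
    by (auto simp: closed_segment_def)
  have A: "path_image ?A \<subseteq> ?S"
    using path_image_right_arc[OF _ R] by force
  have cv: "convex ?S" by (rule convex_halfspace_Re_gt)
  have "contour_integral (?A +++ reversepath ?L) ?f = 0"
    using L A ends
    by (intro contour_integral_unique Cauchy_theorem_convex_simple[OF hol cv])
       (auto simp: path_image_join path_image_reversepath simp del: path_image_linepath reversepath_linepath)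
  moreover have "?f contour_integrable_on ?A" "?f contour_integrable_on ?L"
    using contour_integrable_holomorphic_simple[OF hol] A L by (auto simp: open_halfspace_Re_gt)
  ultimately have "contour_integral ?A ?f + contour_integral (reversepath ?L) ?f = 0"
    by (subst (asm) contour_integral_join) (simp_all only: valid_path_part_circlepath
      valid_path_linepath valid_path_reversepath contour_integrable_reversepath)
  then have "contour_integral ?A ?f = contour_integral ?L ?f"
    by (simp only: contour_integral_reversepath valid_path_linepath add_uminus_conv_diff right_minus_eq)
  with has_contour_integral_vertical_segment[OF R, of y] show ?thesis
    by (simp add: contour_integral_unique)
qed

text \<open>The pole of order 3 at 0 contributes half the second derivative of \<open>exp(yz)\<close>.\<close>
lemma full_circle_integral:
  assumes R: "1 < R"
  shows "((\<lambda>z. exp (of_real y * z) / z ^ 3) has_contour_integral \<i> * pi * y\<^sup>2) (circlepath 1 R)"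
proof -
  have 1: "(deriv ^^ 2) (\<lambda>z::complex. exp (of_real y * z)) 0 = y\<^sup>2"
  proof -
    have "deriv (\<lambda>z::complex. exp (of_real y * z)) = (\<lambda>z. of_real y * exp (of_real y * z))"
      by (intro ext DERIV_imp_deriv) (auto intro!: derivative_eq_intros)
    moreover have "deriv (\<lambda>z::complex. of_real y * exp (of_real y * z)) 0 = of_real y * of_real y"
      by (intro DERIV_imp_deriv) (auto intro!: derivative_eq_intros)
    ultimately show ?thesis by (simp add: numeral_2_eq_2)
  qed
  have "((\<lambda>u::complex. exp (of_real y * u) / (u - 0) ^ Suc 2) has_contour_integral
          (2 * pi * \<i>) / fact 2 * (deriv ^^ 2) (\<lambda>z. exp (of_real y * z)) 0) (circlepath 1 R)"
    using R by (intro Cauchy_has_contour_integral_higher_derivative_circlepath continuous_intros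
        holomorphic_intros) auto
  moreover have "(2 * pi * \<i>) / fact 2 * y\<^sup>2 = \<i> * pi * y\<^sup>2" by (simp add: fact_numeral)
  moreover have "Suc 2 = 3" by simp
  ultimately show ?thesis by (simp only: 1 diff_zero)
qed

text \<open>Splitting the whole circle into two arcs gives the integral over the left half without any
  winding number of a half-disc around the pole.\<close>
lemma full_circle_eq_arcs:
  assumes R: "1 < R"
  shows "\<i> * pi * y\<^sup>2 =
    contour_integral (part_circlepath 1 R (-pi/2) (pi/2)) (\<lambda>z. exp (of_real y * z) / z ^ 3) +
    contour_integral (part_circlepath 1 R (pi/2) (3*pi/2)) (\<lambda>z. exp (of_real y * z) / z ^ 3)"
proof -
  let ?f = "\<lambda>z::complex. exp (of_real y * z) / z ^ 3"
  define g where "g t = ?f (1 + of_real R * cis t) * of_real R * \<i> * cis t" for t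
  have nz: "1 + of_real R * cis t \<noteq> 0" for t
  proof
    assume "1 + of_real R * cis t = 0"
    then have "cmod (of_real R * cis t) = cmod (-1)"
      by (metis add.commute add_eq_0_iff)
    then show False using R by (simp add: norm_mult)
  qed
  have cont: "continuous_on A g" for A
    unfolding g_def using nz by (intro continuous_intros) auto
  have int: "g integrable_on {a..b}" for a b
    by (rule integrable_continuous_real[OF cont])
  have arc: "contour_integral (part_circlepath 1 R a b) ?f = integral {a..b} g" if "a < b" for a b
    unfolding g_def by (rule contour_integral_part_circlepath_eq[OF that])
  have "\<i> * pi * y\<^sup>2 = integral {0..2*pi} g"
    using contour_integral_unique[OF full_circle_integral[OF R, of y]]
    by (simp add: circlepath_def arc)
  also have "\<dots> = integral {0..pi/2} g + integral {pi/2..3*pi/2} g + integral {3*pi/2..2*pi} g"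
    using Henstock_Kurzweil_Integration.integral_combine[OF _ _ int, of 0 "3*pi/2" "2*pi"]
      Henstock_Kurzweil_Integration.integral_combine[OF _ _ int, of 0 "pi/2" "3*pi/2"]
    by simp
  also have "integral {3*pi/2..2*pi} g = integral {-pi/2..0} (g \<circ> (\<lambda>t. t + 2*pi))"
    using integral_shift[OF cont, of "-pi/2" 0 "2*pi"] by (simp add: o_def)
  also have "g \<circ> (\<lambda>t. t + 2*pi) = g"
    by (simp add: g_def fun_eq_iff cis.ctr)
  finally have *: "\<i> * pi * y\<^sup>2 =
      integral {0..pi/2} g + integral {pi/2..3*pi/2} g + integral {-pi/2..0} g" .
  have h: "integral {-pi/2..0} g + integral {0..pi/2} g = integral {-pi/2..pi/2} g"
    using pi_gt_zero by (intro Henstock_Kurzweil_Integration.integral_combine int) auto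
  have "\<i> * pi * y\<^sup>2 = integral {-pi/2..pi/2} g + integral {pi/2..3*pi/2} g"
    unfolding * h[symmetric] by (simp only: ac_simps)
  also have "integral {-pi/2..pi/2} g = contour_integral (part_circlepath 1 R (-pi/2) (pi/2)) ?f"
    by (rule arc[symmetric]) simp
  also have "integral {pi/2..3*pi/2} g = contour_integral (part_circlepath 1 R (pi/2) (3*pi/2)) ?f"
    by (rule arc[symmetric]) simp
  finally show ?thesis by (simp only: of_real_power)
qed

text \<open>Perron's formula of order 2. For \<open>y \<le> 0\<close> the segment is deformed to the right arc, which
  vanishes in the limit; for \<open>y > 0\<close> the left arc vanishes and the residue at 0 is left over.\<close>
lemma integral_riesz_kernel:
  "(LBINT u. riesz_kernel y u) = of_real (pi * (max 0 y)\<^sup>2)"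
proof -
  let ?f = "\<lambda>z::complex. exp (of_real y * z) / z ^ 3"
  have b0: "((\<lambda>R. exp \<bar>y\<bar> / (R - 1) ^ 3 * R * pi) \<longlongrightarrow> 0) at_top"
    by real_asymp
  have "((\<lambda>R. integral {-R..R} (riesz_kernel y)) \<longlongrightarrow> of_real (pi * (max 0 y)\<^sup>2)) at_top"
  proof (cases "y \<le> 0")
    case True
    have "((\<lambda>R. integral {-R..R} (riesz_kernel y)) \<longlongrightarrow> 0) at_top"
    proof (rule Lim_null_comparison[OF _ b0])
      show "\<forall>\<^sub>F R in at_top. cmod (integral {-R..R} (riesz_kernel y)) \<le> exp \<bar>y\<bar> / (R - 1) ^ 3 * R * pi"
        using eventually_gt_at_top[of "1::real"]
      proof eventually_elim
        case (elim R)
        have "cmod (integral {-R..R} (riesz_kernel y)) = cmod (\<i> * integral {-R..R} (riesz_kernel y))"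
          by (simp add: norm_mult)
        also have "\<dots> \<le> exp \<bar>y\<bar> / (R - 1) ^ 3 * R * pi"
          unfolding vertical_segment_eq_right_arc[of R y, OF order.strict_trans[OF zero_less_one elim]]
          by (rule right_arc_bound[OF elim True])
        finally show ?case .
      qed
    qed
    with True show ?thesis by simp
  next
    case False
    have "((\<lambda>R. integral {-R..R} (riesz_kernel y) - pi * y\<^sup>2) \<longlongrightarrow> 0) at_top"
    proof (rule Lim_null_comparison[OF _ b0])
      show "\<forall>\<^sub>F R in at_top. cmod (integral {-R..R} (riesz_kernel y) - pi * y\<^sup>2) \<le> exp \<bar>y\<bar> / (R - 1) ^ 3 * R * pi"
        using eventually_gt_at_top[of "1::real"]
      proof eventually_elim
        case (elim R)
        have R0: "0 < R" using elim by simp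
        have "\<i> * (integral {-R..R} (riesz_kernel y) - pi * y\<^sup>2) =
            \<i> * integral {-R..R} (riesz_kernel y) - \<i> * pi * y\<^sup>2"
          by (simp only: right_diff_distrib of_real_mult of_real_power mult.assoc)
        also have "\<dots> = - contour_integral (part_circlepath 1 R (pi/2) (3*pi/2)) ?f"
          unfolding vertical_segment_eq_right_arc[OF R0] of_real_power full_circle_eq_arcs[OF elim] by simp
        finally have "cmod (\<i> * (integral {-R..R} (riesz_kernel y) - pi * y\<^sup>2)) =
            cmod (contour_integral (part_circlepath 1 R (pi/2) (3*pi/2)) ?f)"
          by (simp only: norm_minus_cancel)
        then have "cmod (integral {-R..R} (riesz_kernel y) - pi * y\<^sup>2) =
            cmod (contour_integral (part_circlepath 1 R (pi/2) (3*pi/2)) ?f)"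
          by (simp only: norm_mult norm_ii mult_1)
        also have "\<dots> \<le> exp \<bar>y\<bar> / (R - 1) ^ 3 * R * pi"
          using elim False by (intro left_arc_bound) simp_all
        finally show ?case .
      qed
    qed
    then have "((\<lambda>R. integral {-R..R} (riesz_kernel y)) \<longlongrightarrow> pi * y\<^sup>2) at_top"
      by (simp add: LIM_zero_iff)
    with False show ?thesis by simp
  qed
  moreover have "((\<lambda>R. integral {-R..R} (riesz_kernel y)) \<longlongrightarrow> (LBINT u. riesz_kernel y u)) at_top"
  proof -
    have "((\<lambda>R. LBINT u. indicator {-R..R} u *\<^sub>R riesz_kernel y u) \<longlongrightarrow> (LBINT u. riesz_kernel y u)) at_top"
    proof (rule integral_dominated_convergence_at_top)
      show "integrable lborel (\<lambda>u. cmod (riesz_kernel y u))"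
        by (intro integrable_norm integrable_riesz_kernel)
      show "AE u in lborel. ((\<lambda>R. indicator {-R..R} u *\<^sub>R riesz_kernel y u) \<longlongrightarrow> riesz_kernel y u) at_top"
      proof (rule AE_I2, rule tendsto_eventually)
        fix u :: real
        show "\<forall>\<^sub>F R in at_top. indicator {-R..R} u *\<^sub>R riesz_kernel y u = riesz_kernel y u"
          using eventually_ge_at_top[of "\<bar>u\<bar>"]
        proof eventually_elim
          case (elim R)
          then have "u \<in> {-R..R}" by auto
          then show ?case by simp
        qed
      qed
    qed (auto simp: indicator_def)
    moreover have "(LBINT u. indicator {-R..R} u *\<^sub>R riesz_kernel y u) = integral {-R..R} (riesz_kernel y)" for R
      using set_borel_integral_eq_integral(2)[of "{-R..R}" "riesz_kernel y"]
        set_integrable_subset[of lborel UNIV "riesz_kernel y" "{-R..R}"] integrable_riesz_kernel[of y]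
      by (simp add: set_integrable_def set_lebesgue_integral_def)
    ultimately show ?thesis by simp
  qed
  ultimately show ?thesis
    using tendsto_unique trivial_limit_at_top_linorder by blast
qed

section \<open>Riesz means of general Dirichlet series\<close>

text \<open>This is \<open>|\<integral>\<^sub>a\<^sup>b v exp(-xv) dx| \<le> |v| \<integral>\<^sub>a\<^sup>b exp(-x Re v) dx\<close>.\<close>
lemma norm_diff_exp_le:
  assumes v: "0 < Re v" and ab: "a \<le> b"
  shows "cmod (exp (- of_real a * v) - exp (- of_real b * v))
           \<le> cmod v / Re v * (exp (- a * Re v) - exp (- b * Re v))"
proof (cases "a = b")
  case False
  let ?f = "\<lambda>x::real. exp (- of_real x * v)" and ?g = "\<lambda>x. - (cmod v / Re v) * exp (- x * Re v)"
  have "cmod (?f b - ?f a) \<le> ?g b - ?g a"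
  proof (rule differentiable_bound_general)
    show "a < b" using ab False by simp
    show "continuous_on {a..b} ?f" "continuous_on {a..b} ?g" by (intro continuous_intros)+
    show "(?f has_vector_derivative - v * exp (- of_real x * v)) (at x)" for x
      by (auto intro!: derivative_eq_intros has_vector_derivative_real_field)
    show "(?g has_vector_derivative cmod v * exp (- x * Re v)) (at x)" for x
      using v unfolding has_real_derivative_iff_has_vector_derivative[symmetric]
      by (auto intro!: derivative_eq_intros)
    show "cmod (- v * exp (- of_real x * v)) \<le> cmod v * exp (- x * Re v)" for x
      by (simp add: norm_mult)
  qed
  then show ?thesis by (simp add: norm_minus_commute algebra_simps)
qed simp

text \<open>Abel summation: bounded partial sums at one point stay bounded after a translation by \<open>v\<close>,
  with the classical factor \<open>|v| / Re v\<close> of Stolz angles. On the line \<open>Re v = 1/X\<close> this factor is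
  the linear growth that the Riesz kernel absorbs.\<close>
lemma abel_bound:
  fixes b :: "nat \<Rightarrow> complex" and lam :: "nat \<Rightarrow> real"
  assumes mono: "mono lam" and nonneg: "\<And>n. 0 \<le> lam n" and v: "0 < Re v"
    and B: "\<And>n. cmod (\<Sum>i<n. b i) \<le> B"
  shows "cmod (\<Sum>i<n. b i * exp (- of_real (lam i) * v)) \<le> B * (cmod v / Re v)"
proof -
  define E where "E i = exp (- of_real (lam i) * v)" for i
  define e where "e i = exp (- lam i * Re v)" for i
  define \<kappa> where "\<kappa> = cmod v / Re v"
  have B0: "0 \<le> B" using B[of 0] by simp
  have \<kappa>: "1 \<le> \<kappa>" using v complex_Re_le_cmod[of v] by (simp add: \<kappa>_def)
  have e1: "0 \<le> e i" "e i \<le> 1" for i using v nonneg[of i] by (auto simp: e_def)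
  have normE: "cmod (E i) = e i" for i by (simp add: E_def e_def)
  have d: "cmod (E i - E (Suc i)) \<le> \<kappa> * (e i - e (Suc i))" for i
    unfolding E_def e_def \<kappa>_def using mono by (intro norm_diff_exp_le v) (auto simp: mono_iff_le_Suc)
  have abel: "(\<Sum>i<Suc n. b i * E i) = (\<Sum>i<Suc n. b i) * E n + (\<Sum>j<n. (\<Sum>i<Suc j. b i) * (E j - E (Suc j)))" for n
    by (induction n) (simp_all add: algebra_simps)
  show ?thesis
  proof (cases n)
    case 0
    then show ?thesis using B0 \<kappa> by (simp flip: \<kappa>_def)
  next
    case (Suc m)
    have d0: "0 \<le> \<kappa> * (e i - e (Suc i))" for i using order_trans[OF norm_ge_zero d] .
    have last: "cmod (\<Sum>i<Suc m. b i) * cmod (E m) \<le> B * (\<kappa> * e m)"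
      using B[of "Suc m"] mult_right_mono[OF \<kappa> e1(1)[of m]] B0 e1(1)[of m]
      by (intro mult_mono) (simp_all only: normE mult_1 norm_ge_zero)
    have "cmod (\<Sum>i<n. b i * E i) \<le> cmod ((\<Sum>i<Suc m. b i) * E m) + (\<Sum>j<m. cmod ((\<Sum>i<Suc j. b i) * (E j - E (Suc j))))"
      unfolding Suc abel by (intro order_trans[OF norm_triangle_ineq] add_left_mono norm_sum)
    also have "\<dots> \<le> B * (\<kappa> * e m) + (\<Sum>j<m. B * (\<kappa> * (e j - e (Suc j))))"
      unfolding norm_mult by (intro add_mono last sum_mono mult_mono B d B0 norm_ge_zero)
    also have "\<dots> = B * \<kappa> * (e m + (\<Sum>j<m. e j - e (Suc j)))"
      by (simp add: sum_distrib_left algebra_simps)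
    also have "(\<Sum>j<m. e j - e (Suc j)) = e 0 - e m"
      by (rule sum_lessThan_telescope')
    also have "B * \<kappa> * (e m + (e 0 - e m)) \<le> B * \<kappa>"
      using e1[of 0] B0 \<kappa> by (simp add: mult_left_le)
    finally show ?thesis by (simp add: E_def \<kappa>_def)
  qed
qed

lemma dirichlet_term_add:
  "dirichlet_term lam a (s + v) n = dirichlet_term lam a s n * exp (- of_real (lam n) * v)"
  by (simp add: dirichlet_term_def exp_add[symmetric] algebra_simps)

definition riesz_weight :: "(nat \<Rightarrow> real) \<Rightarrow> real \<Rightarrow> nat \<Rightarrow> real" where
  "riesz_weight lam X n = (max 0 (1 - lam n / X))\<^sup>2"

text \<open>Perron's formula turns the Riesz mean into an average of the translates
  \<open>D(s + (1 + iu)/X)\<close>. It is exact for the finite partial sums, and the Abel bound allows dominated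
  convergence where the series itself converges only conditionally.\<close>
lemma riesz_mean_bound:
  assumes freq: "frequency lam" and X: "0 < X" "X \<le> lam N" and s: "0 < Re s"
    and conv: "\<And>s. 0 < Re s \<Longrightarrow> summable (dirichlet_term lam a s)"
    and M: "\<And>u. cmod (dirichlet_fun lam a (s + Complex 1 u / of_real X)) \<le> M"
  shows "cmod (\<Sum>n<N. of_real (riesz_weight lam X n) * dirichlet_term lam a s n) \<le> exp 1 * M"
proof -
  define b where "b = dirichlet_term lam a s"
  define v where "v u = Complex 1 u / of_real X" for u
  define S where "S K u = (\<Sum>n<K. b n * exp (- of_real (lam n) * v u))" for K u
  define D where "D u = dirichlet_fun lam a (s + v u)" for u
  have lam: "mono lam" "\<And>n. 0 \<le> lam n"
    using freq by (auto simp: frequency_def strict_mono_mono)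
  have v: "Re (v u) = 1 / X" "cmod (v u) / Re (v u) = cmod (Complex 1 u)" for u
    using X by (simp_all add: v_def norm_divide)
  have trm: "dirichlet_term lam a (s + v u) n = b n * exp (- of_real (lam n) * v u)" for u n
    by (simp add: b_def dirichlet_term_add)
  have lim: "(\<lambda>K. S K u) \<longlonglongrightarrow> D u" for u
  proof -
    have "summable (dirichlet_term lam a (s + v u))"
      using s X by (intro conv) (simp add: v add_pos_pos)
    then show ?thesis
      unfolding S_def D_def dirichlet_fun_def trm[symmetric] by (rule summable_LIMSEQ)
  qed
  have "Bseq (\<lambda>n. \<Sum>i<n. b i)"
    using summable_LIMSEQ[OF conv[OF s]] convergent_imp_Bseq unfolding b_def convergent_def by blast
  then obtain B where B: "\<And>n. cmod (\<Sum>i<n. b i) \<le> B"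
    by (auto simp: Bseq_def)
  have S_le: "cmod (S K u) \<le> B * cmod (Complex 1 u)" for K u
  proof -
    have "0 < Re (v u)" using X by (simp add: v(1))
    from abel_bound[OF lam this B, of K] show ?thesis unfolding S_def v(2) .
  qed
  have kernel: "exp (- of_real (lam n) * v u) * riesz_kernel 1 u = riesz_kernel (1 - lam n / X) u" for n u
    using X by (simp add: riesz_kernel_def v_def exp_add[symmetric] algebra_simps)
  have int_S: "(LBINT u. S K u * riesz_kernel 1 u) = of_real pi * (\<Sum>n<K. of_real (riesz_weight lam X n) * b n)" for K
  proof -
    have "(LBINT u. S K u * riesz_kernel 1 u) = (LBINT u. \<Sum>n<K. b n * riesz_kernel (1 - lam n / X) u)"
      by (simp add: S_def sum_distrib_right mult.assoc flip: kernel)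
    also have "\<dots> = (\<Sum>n<K. b n * (LBINT u. riesz_kernel (1 - lam n / X) u))"
      by (subst Bochner_Integration.integral_sum) (simp_all add: integrable_riesz_kernel)
    also have "\<dots> = of_real pi * (\<Sum>n<K. of_real (riesz_weight lam X n) * b n)"
      by (simp add: integral_riesz_kernel riesz_weight_def sum_distrib_left mult_ac)
    finally show ?thesis .
  qed
  have S_meas [measurable]: "S K \<in> borel_measurable borel" for K
    unfolding S_def v_def Complex_eq by (intro borel_measurable_continuous_onI continuous_intros)  (use X in auto)
  have D_meas [measurable]: "D \<in> borel_measurable borel"
    by (rule borel_measurable_LIMSEQ_metric[OF S_meas lim])
  have pos: "0 < 1 + u\<^sup>2" for u :: real by (smt (verit) zero_le_power2)
  have "(\<lambda>K. LBINT u. S K u * riesz_kernel 1 u) \<longlonglongrightarrow> (LBINT u. D u * riesz_kernel 1 u)"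
  proof (rule integral_dominated_convergence)
    show "integrable lborel (\<lambda>u. B * exp 1 * (1 / (1 + u\<^sup>2)))"
      by (intro integrable_mult_right integrable_inverse_one_plus_square)
    show "AE u in lborel. (\<lambda>K. S K u * riesz_kernel 1 u) \<longlonglongrightarrow> D u * riesz_kernel 1 u"
      by (intro AE_I2 tendsto_mult lim tendsto_const)
    show "AE u in lborel. cmod (S K u * riesz_kernel 1 u) \<le> B * exp 1 * (1 / (1 + u\<^sup>2))" for K
    proof (rule AE_I2)
      fix u
      have "cmod (S K u * riesz_kernel 1 u) \<le> B * cmod (Complex 1 u) * cmod (riesz_kernel 1 u)"
        unfolding norm_mult by (intro mult_right_mono S_le) simp
      then show "cmod (S K u * riesz_kernel 1 u) \<le> B * exp 1 * (1 / (1 + u\<^sup>2))"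
        by (simp add: mult.assoc norm_Complex_1_times_riesz_kernel)
    qed
  qed simp_all
  moreover have "(\<lambda>K. LBINT u. S K u * riesz_kernel 1 u) \<longlonglongrightarrow>
      of_real pi * (\<Sum>n<N. of_real (riesz_weight lam X n) * b n)"
  proof (rule tendsto_eventually)
    have "riesz_weight lam X n = 0" if "N \<le> n" for n
      using X order_trans[OF X(2) monoD[OF lam(1) that]] by (simp add: riesz_weight_def max_def)
    then have stable: "(\<Sum>n<K. of_real (riesz_weight lam X n) * b n) = (\<Sum>n<N. of_real (riesz_weight lam X n) * b n)"
      if "N \<le> K" for K
      using that by (intro sum.mono_neutral_right) auto
    show "\<forall>\<^sub>F K in sequentially. (LBINT u. S K u * riesz_kernel 1 u) =
        of_real pi * (\<Sum>n<N. of_real (riesz_weight lam X n) * b n)"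
    proof (rule eventually_sequentiallyI)
      fix K assume K: "N \<le> K"
      show "(LBINT u. S K u * riesz_kernel 1 u) = of_real pi * (\<Sum>n<N. of_real (riesz_weight lam X n) * b n)"
        unfolding int_S stable[OF K] ..
    qed
  qed
  ultimately have eq: "(LBINT u. D u * riesz_kernel 1 u) = of_real pi * (\<Sum>n<N. of_real (riesz_weight lam X n) * b n)"
    by (rule LIMSEQ_unique)
  have D_riesz: "cmod (D u * riesz_kernel 1 u) \<le> M * exp 1 * (1 / (1 + u\<^sup>2))" for u
    using mult_mono[OF M[of u] norm_riesz_kernel_le[of 1 u]] order_trans[OF norm_ge_zero M[of u]]
    by (simp add: D_def v_def norm_mult)
  have int_M: "integrable lborel (\<lambda>u. M * exp 1 * (1 / (1 + u\<^sup>2)))"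
    by (intro integrable_mult_right integrable_inverse_one_plus_square)
  have "cmod (LBINT u. D u * riesz_kernel 1 u) \<le> (LBINT u. M * exp 1 * (1 / (1 + u\<^sup>2)))"
  proof (rule Bochner_Integration.integral_norm_bound_integral[OF _ int_M D_riesz])
    show "integrable lborel (\<lambda>u. D u * riesz_kernel 1 u)"
    proof (rule Bochner_Integration.integrable_bound[OF int_M])
      show "AE u in lborel. cmod (D u * riesz_kernel 1 u) \<le> norm (M * exp 1 * (1 / (1 + u\<^sup>2)))"
        unfolding real_norm_def by (intro AE_I2 order_trans[OF D_riesz abs_ge_self])
    qed simp
  qed
  also have "\<dots> = M * exp 1 * (LBINT u. 1 / (1 + u\<^sup>2))"
    by (rule integral_mult_right_zero)
  also have "\<dots> = M * exp 1 * pi"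
    by (simp only: lebesgue_integral_inverse_one_plus_square)
  finally show ?thesis
    unfolding eq norm_mult b_def by (simp add: mult_ac)
qed

section \<open>Local spaces of norms\<close>

lemma local_norm_singleton: "local_norm p {x} = p x"
  by (simp add: local_norm_def)

lemma set_add_singletons: "{x} <+>\<^bsub>E\<^esub> {y} = {x \<oplus>\<^bsub>E\<^esub> y}"
  by (simp add: set_add_def')

context
  fixes E :: "(complex, 'v) module" and p :: "'v \<Rightarrow> real"
  assumes vs: "complex_vector_space E" and ker: "seminorm_kernel E p = {\<zero>\<^bsub>E\<^esub>}"
begin

interpretation E: Module.module "cring_class_ops :: complex ring" E by (fact vs)

lemma carrier_local_space: "carrier (local_space E p) = (\<lambda>x. {x}) ` carrier E"
  by (auto simp: local_space_def quotient_space_def ker A_RCOSETS_def' a_r_coset_def')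

lemma zero_local_space: "\<zero>\<^bsub>local_space E p\<^esub> = {\<zero>\<^bsub>E\<^esub>}"
  by (simp add: local_space_def quotient_space_def ker)

lemma add_local_space: "{x} \<oplus>\<^bsub>local_space E p\<^esub> {y} = {x \<oplus>\<^bsub>E\<^esub> y}"
  by (simp add: local_space_def quotient_space_def set_add_singletons)

lemma smult_local_space:
  "x \<in> carrier E \<Longrightarrow> c \<odot>\<^bsub>local_space E p\<^esub> {x} = {c \<odot>\<^bsub>E\<^esub> x}"
  by (simp add: local_space_def quotient_space_def ker set_add_singletons E.smult_closed carrier_class)

lemma abelian_group_local_space: "abelian_group (local_space E p)"
proof (rule abelian_groupI)
  fix A assume "A \<in> carrier (local_space E p)"
  then obtain x where "x \<in> carrier E" "A = {x}" by (auto simp: carrier_local_space)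
  then show "\<exists>B\<in>carrier (local_space E p). B \<oplus>\<^bsub>local_space E p\<^esub> A = \<zero>\<^bsub>local_space E p\<^esub>"
    by (intro bexI[of _ "{\<ominus>\<^bsub>E\<^esub> x}"]) (auto simp: carrier_local_space add_local_space zero_local_space E.M.l_neg)
qed (auto simp: carrier_local_space zero_local_space add_local_space E.M.a_ac)

interpretation Q: abelian_group "local_space E p" by (fact abelian_group_local_space)

lemma minus_local_space:
  assumes "x \<in> carrier E" "y \<in> carrier E"
  shows "{x} \<ominus>\<^bsub>local_space E p\<^esub> {y} = {x \<ominus>\<^bsub>E\<^esub> y}"
proof -
  have "\<ominus>\<^bsub>local_space E p\<^esub> {y} = {\<ominus>\<^bsub>E\<^esub> y}"
    using assms by (intro Q.minus_equality) (auto simp: carrier_local_space add_local_space zero_local_space E.M.l_neg)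
  then show ?thesis by (simp add: a_minus_def add_local_space)
qed

lemma finsum_local_space:
  assumes "finite I" "\<And>i. i \<in> I \<Longrightarrow> h i \<in> carrier E"
  shows "(\<Oplus>\<^bsub>local_space E p\<^esub>i\<in>I. {h i}) = {\<Oplus>\<^bsub>E\<^esub>i\<in>I. h i}"
  using assms
proof (induction I rule: finite_induct)
  case empty
  then show ?case by (simp add: zero_local_space)
next
  case (insert i I)
  then have "h \<in> I \<rightarrow> carrier E" "(\<lambda>i. {h i}) \<in> I \<rightarrow> carrier (local_space E p)"
    by (auto simp: carrier_local_space)
  with insert show ?case
    by (simp add: Q.finsum_insert E.M.finsum_insert carrier_local_space add_local_space)
qed

lemma dual_space_local_space:
  "f \<in> dual_space (local_space E p) (local_norm p) \<longleftrightarrow> (\<lambda>x. f {x}) \<in> dual_space E p"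
  by (simp add: dual_space_def carrier_local_space add_local_space smult_local_space local_norm_singleton)

lemma dual_norm_local_space:
  "dual_norm (local_space E p) (local_norm p) f = dual_norm E p (\<lambda>x. f {x})"
proof -
  have "{A \<in> carrier (local_space E p). local_norm p A \<le> 1} = (\<lambda>x. {x}) ` {x \<in> carrier E. p x \<le> 1}"
    by (auto simp: carrier_local_space local_norm_singleton)
  then show ?thesis by (simp add: dual_norm_def image_image)
qed

end

text \<open>If \<open>p\<close> and \<open>q\<close> are norms, the cosets are singletons, and nuclearity of the canonical map is a
  statement about the identity of \<open>E\<close>, from the norm \<open>p\<close> to the norm \<open>q\<close>.\<close>
lemma nuclear_canonical_map_iff:
  fixes E :: "(complex, 'v) module"
  assumes vs: "complex_vector_space E"
    and ker: "seminorm_kernel E p = {\<zero>\<^bsub>E\<^esub>}" "seminorm_kernel E q = {\<zero>\<^bsub>E\<^esub>}"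
  shows "nuclear_operator (local_space E p) (local_norm p) (local_space E q) (local_norm q) (canonical_map E q)
    \<longleftrightarrow> (\<exists>(f :: nat \<Rightarrow> 'v \<Rightarrow> complex) y. (\<forall>n. f n \<in> dual_space E p) \<and> (\<forall>n. y n \<in> carrier E) \<and>
          summable (\<lambda>n. dual_norm E p (f n) * q (y n)) \<and>
          (\<forall>x\<in>carrier E. (\<lambda>m. q (x \<ominus>\<^bsub>E\<^esub> (\<Oplus>\<^bsub>E\<^esub>n\<in>{..<m}. f n x \<odot>\<^bsub>E\<^esub> y n))) \<longlonglongrightarrow> 0))"
    (is "?N \<longleftrightarrow> ?R")
proof -
  interpret E: Module.module "cring_class_ops :: complex ring" E by (fact vs)
  note p_simps = carrier_local_space[OF vs ker(1)] dual_space_local_space[OF vs ker(1)]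
    dual_norm_local_space[OF vs ker(1)] add_local_space[OF vs ker(1)] smult_local_space[OF vs ker(1)]
  note q_simps = carrier_local_space[OF vs ker(2)] add_local_space[OF vs ker(2)] smult_local_space[OF vs ker(2)]
  have can: "canonical_map E q {x} = {x}" if "x \<in> carrier E" for x
    using that by (simp add: canonical_map_def ker set_add_singletons)
  have lin: "linear_map (local_space E p) (local_space E q) (canonical_map E q)"
    by (auto simp: linear_map_def p_simps q_simps can E.smult_closed carrier_class)
  have remainder: "local_norm q (canonical_map E q {x} \<ominus>\<^bsub>local_space E q\<^esub>
        (\<Oplus>\<^bsub>local_space E q\<^esub>n\<in>{..<m}. f n x \<odot>\<^bsub>local_space E q\<^esub> {y n}))
      = q (x \<ominus>\<^bsub>E\<^esub> (\<Oplus>\<^bsub>E\<^esub>n\<in>{..<m}. f n x \<odot>\<^bsub>E\<^esub> y n))"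
    if "x \<in> carrier E" "\<forall>n. y n \<in> carrier E" for x m and f :: "nat \<Rightarrow> 'v \<Rightarrow> complex" and y
  proof -
    have "f n x \<odot>\<^bsub>E\<^esub> y n \<in> carrier E" for n
      using that by (simp add: E.smult_closed carrier_class)
    moreover from this have "(\<Oplus>\<^bsub>E\<^esub>n\<in>{..<m}. f n x \<odot>\<^bsub>E\<^esub> y n) \<in> carrier E"
      by (intro E.M.finsum_closed) auto
    ultimately show ?thesis
      using that by (simp add: can q_simps finsum_local_space[OF vs ker(2)] minus_local_space[OF vs ker(2)]
          local_norm_singleton)
  qed
  show ?thesis
  proof
    assume ?N
    then obtain f Y where f: "\<And>n. f n \<in> dual_space (local_space E p) (local_norm p)"
      and Y: "\<And>n. Y n \<in> carrier (local_space E q)"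
      and sm: "summable (\<lambda>n. dual_norm (local_space E p) (local_norm p) (f n) * local_norm q (Y n))"
      and lim: "\<And>A. A \<in> carrier (local_space E p) \<Longrightarrow>
        (\<lambda>m. local_norm q (canonical_map E q A \<ominus>\<^bsub>local_space E q\<^esub>
          (\<Oplus>\<^bsub>local_space E q\<^esub>n\<in>{..<m}. f n A \<odot>\<^bsub>local_space E q\<^esub> Y n))) \<longlonglongrightarrow> 0"
      unfolding nuclear_operator_def by blast
    from Y have "\<forall>n. \<exists>y. y \<in> carrier E \<and> Y n = {y}" by (auto simp: q_simps)
    then obtain y where y: "\<And>n. y n \<in> carrier E" "\<And>n. Y n = {y n}" by metis
    show ?R
    proof (intro exI[of _ "\<lambda>n x. f n {x}"] exI[of _ y] conjI allI ballI)
      show "(\<lambda>x. f n {x}) \<in> dual_space E p" for n using f by (simp add: p_simps)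
      show "y n \<in> carrier E" for n by (rule y)
      show "summable (\<lambda>n. dual_norm E p (\<lambda>x. f n {x}) * q (y n))"
        using sm by (simp add: p_simps y(2) local_norm_singleton)
      show "(\<lambda>m. q (x \<ominus>\<^bsub>E\<^esub> (\<Oplus>\<^bsub>E\<^esub>n\<in>{..<m}. f n {x} \<odot>\<^bsub>E\<^esub> y n))) \<longlonglongrightarrow> 0" if "x \<in> carrier E" for x
        using lim[of "{x}"] that y(1) remainder[of x y "\<lambda>n x. f n {x}"] by (simp add: p_simps y(2))
    qed
  next
    assume ?R
    then obtain f :: "nat \<Rightarrow> 'v \<Rightarrow> complex" and y where f: "\<And>n. f n \<in> dual_space E p"
      and y: "\<forall>n. y n \<in> carrier E"
      and sm: "summable (\<lambda>n. dual_norm E p (f n) * q (y n))"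
      and lim: "\<And>x. x \<in> carrier E \<Longrightarrow> (\<lambda>m. q (x \<ominus>\<^bsub>E\<^esub> (\<Oplus>\<^bsub>E\<^esub>n\<in>{..<m}. f n x \<odot>\<^bsub>E\<^esub> y n))) \<longlonglongrightarrow> 0"
      by blast
    show ?N
      unfolding nuclear_operator_def
    proof (intro conjI lin exI[of _ "\<lambda>n A. f n (the_elem A)"] exI[of _ "\<lambda>n. {y n}"] allI ballI)
      show "(\<lambda>A. f n (the_elem A)) \<in> dual_space (local_space E p) (local_norm p)" for n
        using f by (simp add: p_simps)
      show "{y n} \<in> carrier (local_space E q)" for n using y by (simp add: q_simps)
      show "summable (\<lambda>n. dual_norm (local_space E p) (local_norm p) (\<lambda>A. f n (the_elem A)) * local_norm q {y n})"
        using sm by (simp add: p_simps local_norm_singleton)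
      fix A assume "A \<in> carrier (local_space E p)"
      then obtain x where "x \<in> carrier E" "A = {x}" by (auto simp: p_simps)
      then show "(\<lambda>m. local_norm q (canonical_map E q A \<ominus>\<^bsub>local_space E q\<^esub>
          (\<Oplus>\<^bsub>local_space E q\<^esub>n\<in>{..<m}. f n (the_elem A) \<odot>\<^bsub>local_space E q\<^esub> {y n}))) \<longlonglongrightarrow> 0"
        using lim[of x] y remainder[of x y f] by simp
    qed
  qed
qed

text \<open>The supremum in the dual norm is over a bounded set by the definition of the dual space, so the
  usual scaling argument applies; on the kernel of \<open>p\<close> the functional vanishes.\<close>
lemma norm_le_dual_norm:
  assumes vs: "complex_vector_space E" and p: "seminorm E p"
    and f: "f \<in> dual_space E p" and x: "x \<in> carrier E"
  shows "cmod (f x) \<le> dual_norm E p f * p x"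
proof -
  interpret E: Module.module "cring_class_ops :: complex ring" E by (fact vs)
  obtain C where C: "\<And>x. x \<in> carrier E \<Longrightarrow> cmod (f x) \<le> C * p x"
    using f unfolding dual_space_def by blast
  have p0: "0 \<le> p x" using p x by (simp add: seminorm_def)
  show ?thesis
  proof (cases "p x = 0")
    case True
    then show ?thesis using C[OF x] by simp
  next
    case False
    define y where "y = of_real (inverse (p x)) \<odot>\<^bsub>E\<^esub> x"
    have y: "y \<in> carrier E" using x by (simp add: y_def E.smult_closed carrier_class)
    have "p y = cmod (of_real (inverse (p x))) * p x"
      using p x by (simp add: y_def seminorm_def)
    then have py: "p y = 1" using False p0 by (simp add: norm_inverse)
    have "f y = of_real (inverse (p x)) * f x" using f x by (simp add: y_def dual_space_def)
    then have fy: "cmod (f y) = inverse (p x) * cmod (f x)"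
      using p0 by (simp add: norm_mult norm_inverse)
    have "bdd_above ((\<lambda>x. cmod (f x)) ` {x \<in> carrier E. p x \<le> 1})"
      unfolding bdd_above_def
    proof (intro exI ballI)
      fix r assume "r \<in> (\<lambda>x. cmod (f x)) ` {x \<in> carrier E. p x \<le> 1}"
      then obtain z where z: "z \<in> carrier E" "p z \<le> 1" "r = cmod (f z)" by auto
      have "r \<le> C * p z" using C z by simp
      also have "\<dots> \<le> \<bar>C\<bar> * p z" using p z by (intro mult_right_mono) (auto simp: seminorm_def)
      also have "\<dots> \<le> \<bar>C\<bar> * 1" using z by (intro mult_left_mono) auto
      finally show "r \<le> \<bar>C\<bar> * 1" .
    qed
    then have "cmod (f y) \<le> dual_norm E p f"
      unfolding dual_norm_def using y py by (intro cSUP_upper) auto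
    then show ?thesis using False p0 by (simp add: fy field_simps)
  qed
qed

lemma dual_norm_nonneg:
  assumes "complex_vector_space E" "seminorm E p" "f \<in> dual_space E p" "x \<in> carrier E" "0 < p x"
  shows "0 \<le> dual_norm E p f"
proof -
  have "0 \<le> dual_norm E p f * p x"
    using norm_le_dual_norm[OF assms(1-4)] by (rule order_trans[OF norm_ge_zero])
  with assms(5) show ?thesis by (simp add: zero_le_mult_iff)
qed

section \<open>Open sets of a locally convex topology\<close>

lemma topspace_lc_topology: "topspace (lc_topology E P) = carrier E"
  by (auto simp: lc_topology_def topology_generated_by_topspace)

lemma openin_ball:
  assumes "p \<in> P" "x \<in> carrier E" "0 < e"
  shows "openin (lc_topology E P) {y \<in> carrier E. p (y \<ominus>\<^bsub>E\<^esub> x) < e}"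
  unfolding lc_topology_def using assms by (intro topology_generated_by_Basis) blast

lemma seminorm_diff_triangle:
  assumes vs: "complex_vector_space E" and p: "seminorm E p"
    and "x \<in> carrier E" "y \<in> carrier E" "z \<in> carrier E"
  shows "p (x \<ominus>\<^bsub>E\<^esub> z) \<le> p (x \<ominus>\<^bsub>E\<^esub> y) + p (y \<ominus>\<^bsub>E\<^esub> z)"
proof -
  interpret E: Module.module "cring_class_ops :: complex ring" E by (fact vs)
  have "x \<ominus>\<^bsub>E\<^esub> z = (x \<ominus>\<^bsub>E\<^esub> y) \<oplus>\<^bsub>E\<^esub> (y \<ominus>\<^bsub>E\<^esub> z)"
    using assms(3-5) by (simp add: a_minus_def E.M.a_assoc E.M.r_neg1)
  then show ?thesis using p assms(3-5) by (simp add: seminorm_def)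
qed

text \<open>The balls are only a subbase. Directedness makes the balls with a given centre a neighbourhood
  base there, which is what convergence of a filter has to be tested on.\<close>
lemma openin_lc_topology_imp_ball:
  assumes vs: "complex_vector_space E" and P: "directed_seminorms E P"
    and U: "openin (lc_topology E P) U" and l: "l \<in> U"
  shows "\<exists>p\<in>P. \<exists>e>0. \<forall>y\<in>carrier E. p (y \<ominus>\<^bsub>E\<^esub> l) < e \<longrightarrow> y \<in> U"
proof -
  have "generate_topology_on (insert (carrier E)
        {{y \<in> carrier E. p (y \<ominus>\<^bsub>E\<^esub> x) < e} |p x e. p \<in> P \<and> x \<in> carrier E \<and> 0 < e}) U"
    using U unfolding lc_topology_def openin_topology_generated_by_iff .
  then show ?thesis using l
  proof (induction U)
    case (Int A B)
    have "l \<in> A" "l \<in> B" using Int.prems by auto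
    obtain p e where p: "p \<in> P" "0 < e" "\<forall>y\<in>carrier E. p (y \<ominus>\<^bsub>E\<^esub> l) < e \<longrightarrow> y \<in> A"
      using Int.IH(1)[OF \<open>l \<in> A\<close>] by blast
    obtain q d where q: "q \<in> P" "0 < d" "\<forall>y\<in>carrier E. q (y \<ominus>\<^bsub>E\<^esub> l) < d \<longrightarrow> y \<in> B"
      using Int.IH(2)[OF \<open>l \<in> B\<close>] by blast
    obtain r where r: "r \<in> P" "\<And>x. x \<in> carrier E \<Longrightarrow> p x \<le> r x \<and> q x \<le> r x"
      using P p(1) q(1) unfolding directed_seminorms_def by blast
    interpret E: Module.module "cring_class_ops :: complex ring" E by (fact vs)
    have "openin (lc_topology E P) A"
      using Int.hyps(1) unfolding lc_topology_def openin_topology_generated_by_iff .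
    from openin_subset[OF this] have lE: "l \<in> carrier E"
      using \<open>l \<in> A\<close> unfolding topspace_lc_topology by blast
    show ?case
    proof (intro bexI[OF _ r(1)] exI[of _ "min e d"] conjI ballI impI)
      show "0 < min e d" using p q by simp
      fix y assume y: "y \<in> carrier E" "r (y \<ominus>\<^bsub>E\<^esub> l) < min e d"
      then have "p (y \<ominus>\<^bsub>E\<^esub> l) < e" "q (y \<ominus>\<^bsub>E\<^esub> l) < d"
        using r(2)[OF E.M.minus_closed[OF y(1) lE]] by auto
      then show "y \<in> A \<inter> B" using p q y by blast
    qed
  next
    case (UN K)
    then obtain A where "A \<in> K" "l \<in> A" by blast
    then obtain p e where "p \<in> P" "0 < e" "\<forall>y\<in>carrier E. p (y \<ominus>\<^bsub>E\<^esub> l) < e \<longrightarrow> y \<in> A"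
      using UN.IH by blast
    with \<open>A \<in> K\<close> show ?case by blast
  next
    case (Basis B)
    then consider "B = carrier E"
      | p x e where "p \<in> P" "x \<in> carrier E" "0 < e" "B = {y \<in> carrier E. p (y \<ominus>\<^bsub>E\<^esub> x) < e}" by blast
    then show ?case
    proof cases
      case 1
      moreover obtain p where "p \<in> P" using P by (auto simp: directed_seminorms_def)
      ultimately show ?thesis by (intro bexI[of _ p] exI[of _ 1]) auto
    next
      case 2
      have l: "l \<in> carrier E" "p (l \<ominus>\<^bsub>E\<^esub> x) < e" using Basis.prems 2 by auto
      have "seminorm E p" using P 2 by (simp add: directed_seminorms_def)
      then have "y \<in> B" if "y \<in> carrier E" "p (y \<ominus>\<^bsub>E\<^esub> l) < e - p (l \<ominus>\<^bsub>E\<^esub> x)" for y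
        using seminorm_diff_triangle[OF vs _ that(1) l(1) 2(2), of p] that 2 by auto
      with l 2 show ?thesis by (intro bexI[of _ p] exI[of _ "e - p (l \<ominus>\<^bsub>E\<^esub> x)"]) auto
    qed
  qed simp
qed

lemma Hausdorff_lc_topology:
  assumes vs: "complex_vector_space E" and p: "p \<in> P" "seminorm E p" and ker: "seminorm_kernel E p = {\<zero>\<^bsub>E\<^esub>}"
  shows "Hausdorff_space (lc_topology E P)"
  unfolding Hausdorff_space_def topspace_lc_topology
proof (intro allI impI)
  interpret E: Module.module "cring_class_ops :: complex ring" E by (fact vs)
  fix x y assume xy: "x \<in> carrier E \<and> y \<in> carrier E \<and> x \<noteq> y"
  have nonneg: "0 \<le> p z" if "z \<in> carrier E" for z using p(2) that by (simp add: seminorm_def)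
  have sym: "p (u \<ominus>\<^bsub>E\<^esub> v) = p (v \<ominus>\<^bsub>E\<^esub> u)" if "u \<in> carrier E" "v \<in> carrier E" for u v
  proof -
    have "p ((-1) \<odot>\<^bsub>E\<^esub> (v \<ominus>\<^bsub>E\<^esub> u)) = cmod (-1) * p (v \<ominus>\<^bsub>E\<^esub> u)"
      using p(2) E.M.minus_closed[OF that(2,1)] unfolding seminorm_def by blast
    moreover have "(-1) \<odot>\<^bsub>E\<^esub> (v \<ominus>\<^bsub>E\<^esub> u) = \<ominus>\<^bsub>E\<^esub> (v \<ominus>\<^bsub>E\<^esub> u)"
      using E.smult_l_minus[of 1 "v \<ominus>\<^bsub>E\<^esub> u"] E.smult_one[of "v \<ominus>\<^bsub>E\<^esub> u"] that
      by (simp add: carrier_class uminus_class one_class)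
    moreover have "\<ominus>\<^bsub>E\<^esub> (v \<ominus>\<^bsub>E\<^esub> u) = u \<ominus>\<^bsub>E\<^esub> v"
      using that by (simp add: a_minus_def E.M.minus_add E.M.a_comm)
    ultimately show ?thesis by simp
  qed
  have "x \<ominus>\<^bsub>E\<^esub> y \<noteq> \<zero>\<^bsub>E\<^esub>"
  proof
    assume "x \<ominus>\<^bsub>E\<^esub> y = \<zero>\<^bsub>E\<^esub>"
    then have "\<ominus>\<^bsub>E\<^esub> (\<ominus>\<^bsub>E\<^esub> y) = x"
      using xy by (intro E.M.minus_equality) (simp_all add: a_minus_def)
    then show False using xy by (simp add: E.M.minus_minus)
  qed
  then have r: "0 < p (x \<ominus>\<^bsub>E\<^esub> y)"
    using ker nonneg[of "x \<ominus>\<^bsub>E\<^esub> y"] xy unfolding seminorm_kernel_def by force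
  (* Balls of half the distance are disjoint. *)
  let ?r = "p (x \<ominus>\<^bsub>E\<^esub> y) / 2"
  let ?B = "\<lambda>c. {z \<in> carrier E. p (z \<ominus>\<^bsub>E\<^esub> c) < ?r}"
  have p0: "p (z \<ominus>\<^bsub>E\<^esub> z) = 0" if "z \<in> carrier E" for z
    using ker that unfolding seminorm_kernel_def by (auto simp: E.M.r_neg a_minus_def)
  show "\<exists>U V. openin (lc_topology E P) U \<and> openin (lc_topology E P) V \<and> x \<in> U \<and> y \<in> V \<and> disjnt U V"
  proof (rule exI[of _ "?B x"], rule exI[of _ "?B y"], intro conjI openin_ball)
    show "x \<in> ?B x" "y \<in> ?B y" using xy r p0 by auto
    show "disjnt (?B x) (?B y)"
      unfolding disjnt_iff
    proof (intro allI notI)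
      fix z assume z: "z \<in> ?B x \<and> z \<in> ?B y"
      then have "p (x \<ominus>\<^bsub>E\<^esub> y) \<le> p (x \<ominus>\<^bsub>E\<^esub> z) + p (z \<ominus>\<^bsub>E\<^esub> y)"
        using xy by (intro seminorm_diff_triangle[OF vs p(2)]) auto
      with z sym[of x z] xy show False by auto
    qed
  qed (use p xy r in auto)
qed

section \<open>The normed structure of the space of Dirichlet series\<close>

lemma dirichlet_simps:
  "\<zero>\<^bsub>D_infty_plus lam\<^esub> = (\<lambda>n. 0)"
  "a \<oplus>\<^bsub>D_infty_plus lam\<^esub> b = (\<lambda>n. a n + b n)"
  "c \<odot>\<^bsub>D_infty_plus lam\<^esub> a = (\<lambda>n. c * a n)"
  by (simp_all add: D_infty_plus_def)

lemma carrier_D_infty_plus: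
  "a \<in> carrier (D_infty_plus lam) \<longleftrightarrow>
     (\<forall>s. 0 < Re s \<longrightarrow> summable (dirichlet_term lam a s)) \<and>
     (\<forall>\<sigma>>0. bounded (dirichlet_fun lam a ` {s. \<sigma> < Re s}))"
  by (simp add: D_infty_plus_def)

lemma summable_dirichlet_term:
  "a \<in> carrier (D_infty_plus lam) \<Longrightarrow> 0 < Re s \<Longrightarrow> summable (dirichlet_term lam a s)"
  by (simp add: carrier_D_infty_plus)

lemma dirichlet_term_linear:
  "dirichlet_term lam (\<lambda>n. a n + b n) s n = dirichlet_term lam a s n + dirichlet_term lam b s n"
  "dirichlet_term lam (\<lambda>n. c * a n) s n = c * dirichlet_term lam a s n"
  by (simp_all add: dirichlet_term_def algebra_simps)

lemma dirichlet_fun_add: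
  assumes "a \<in> carrier (D_infty_plus lam)" "b \<in> carrier (D_infty_plus lam)" "0 < Re s"
  shows "dirichlet_fun lam (\<lambda>n. a n + b n) s = dirichlet_fun lam a s + dirichlet_fun lam b s"
  using assms unfolding dirichlet_fun_def dirichlet_term_linear[abs_def]
  by (intro suminf_add[symmetric] summable_dirichlet_term)

lemma dirichlet_fun_smult:
  assumes "a \<in> carrier (D_infty_plus lam)" "0 < Re s"
  shows "dirichlet_fun lam (\<lambda>n. c * a n) s = c * dirichlet_fun lam a s"
  using assms unfolding dirichlet_fun_def dirichlet_term_linear[abs_def]
  by (intro suminf_mult summable_dirichlet_term)

lemma D_infty_plus_add_closed:
  assumes "a \<in> carrier (D_infty_plus lam)" "b \<in> carrier (D_infty_plus lam)"
  shows "(\<lambda>n. a n + b n) \<in> carrier (D_infty_plus lam)"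
  unfolding carrier_D_infty_plus
proof (intro conjI allI impI)
  fix s :: complex assume "0 < Re s"
  then show "summable (dirichlet_term lam (\<lambda>n. a n + b n) s)"
    using assms by (simp add: dirichlet_term_linear[abs_def] summable_add summable_dirichlet_term)
next
  fix \<sigma> :: real assume \<sigma>: "0 < \<sigma>"
  have "bounded ((\<lambda>s. dirichlet_fun lam a s + dirichlet_fun lam b s) ` {s. \<sigma> < Re s})"
    using assms \<sigma> by (intro bounded_plus_comp) (simp_all add: carrier_D_infty_plus)
  also have "(\<lambda>s. dirichlet_fun lam a s + dirichlet_fun lam b s) ` {s. \<sigma> < Re s} =
      dirichlet_fun lam (\<lambda>n. a n + b n) ` {s. \<sigma> < Re s}"
    using assms \<sigma> by (intro image_cong) (auto simp: dirichlet_fun_add)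
  finally show "bounded (dirichlet_fun lam (\<lambda>n. a n + b n) ` {s. \<sigma> < Re s})" .
qed

lemma D_infty_plus_smult_closed:
  assumes "a \<in> carrier (D_infty_plus lam)"
  shows "(\<lambda>n. c * a n) \<in> carrier (D_infty_plus lam)"
  unfolding carrier_D_infty_plus
proof (intro conjI allI impI)
  fix s :: complex assume "0 < Re s"
  then show "summable (dirichlet_term lam (\<lambda>n. c * a n) s)"
    using assms by (simp add: dirichlet_term_linear[abs_def] summable_mult summable_dirichlet_term)
next
  fix \<sigma> :: real assume \<sigma>: "0 < \<sigma>"
  have "bounded ((*) c ` dirichlet_fun lam a ` {s. \<sigma> < Re s})"
    using assms \<sigma> by (intro bounded_linear_image[OF _ bounded_linear_mult_right]) (simp add: carrier_D_infty_plus)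
  also have "(*) c ` dirichlet_fun lam a ` {s. \<sigma> < Re s} = dirichlet_fun lam (\<lambda>n. c * a n) ` {s. \<sigma> < Re s}"
    using assms \<sigma> by (auto simp: image_image dirichlet_fun_smult intro!: image_cong)
  finally show "bounded (dirichlet_fun lam (\<lambda>n. c * a n) ` {s. \<sigma> < Re s})" .
qed

lemma D_infty_plus_zero: "(\<lambda>n. 0) \<in> carrier (D_infty_plus lam)"
  by (auto simp: carrier_D_infty_plus dirichlet_fun_def dirichlet_term_def[abs_def]
      intro: bounded_subset[of "{0}"])

lemma complex_vector_space_D_infty_plus: "complex_vector_space (D_infty_plus lam)"
proof (rule moduleI[OF cring_class])
  show "abelian_group (D_infty_plus lam)"
  proof (rule abelian_groupI)
    fix a assume "a \<in> carrier (D_infty_plus lam)"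
    then show "\<exists>b\<in>carrier (D_infty_plus lam). b \<oplus>\<^bsub>D_infty_plus lam\<^esub> a = \<zero>\<^bsub>D_infty_plus lam\<^esub>"
      using D_infty_plus_smult_closed[of a lam "-1"]
      by (intro bexI[of _ "\<lambda>n. - 1 * a n"]) (simp_all add: dirichlet_simps)
  qed (auto simp: dirichlet_simps D_infty_plus_add_closed D_infty_plus_zero algebra_simps)
qed (auto simp: dirichlet_simps D_infty_plus_smult_closed cring_class_ops_def algebra_simps)

interpretation D: Module.module "cring_class_ops :: complex ring" "D_infty_plus lam" for lam
  by (rule complex_vector_space_D_infty_plus)

lemma D_infty_plus_diff:
  assumes "a \<in> carrier (D_infty_plus lam)" "b \<in> carrier (D_infty_plus lam)"
  shows "a \<ominus>\<^bsub>D_infty_plus lam\<^esub> b = (\<lambda>n. a n - b n)"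
proof -
  have "\<ominus>\<^bsub>D_infty_plus lam\<^esub> b = (\<lambda>n. - 1 * b n)"
    using assms D_infty_plus_smult_closed[of b lam "-1"]
    by (intro D.M.minus_equality) (auto simp: dirichlet_simps)
  then show ?thesis by (simp add: a_minus_def dirichlet_simps)
qed

lemma D_infty_plus_diff_closed:
  assumes "a \<in> carrier (D_infty_plus lam)" "b \<in> carrier (D_infty_plus lam)"
  shows "(\<lambda>n. a n - b n) \<in> carrier (D_infty_plus lam)"
  using D.M.minus_closed[OF assms] by (simp add: D_infty_plus_diff assms)

lemma D_infty_plus_finsum:
  assumes "finite I" "\<And>i. i \<in> I \<Longrightarrow> h i \<in> carrier (D_infty_plus lam)"
  shows "(\<Oplus>\<^bsub>D_infty_plus lam\<^esub>i\<in>I. h i) = (\<lambda>n. \<Sum>i\<in>I. h i n)"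
  using assms
proof (induction I rule: finite_induct)
  case empty
  then show ?case by (simp add: dirichlet_simps)
next
  case (insert i I)
  then have "h \<in> I \<rightarrow> carrier (D_infty_plus lam)" by auto
  with insert show ?case by (simp add: D.M.finsum_insert dirichlet_simps)
qed

lemma D_infty_plus_sum_closed:
  assumes "finite I" "\<And>i. i \<in> I \<Longrightarrow> h i \<in> carrier (D_infty_plus lam)"
  shows "(\<lambda>n. \<Sum>i\<in>I. h i n) \<in> carrier (D_infty_plus lam)"
  using D.M.finsum_closed[of h I lam] assms by (auto simp: D_infty_plus_finsum)

lemma norm_dirichlet_fun_le_D_norm:
  assumes "a \<in> carrier (D_infty_plus lam)" "1 \<le> k" "1 / real k < Re s"
  shows "cmod (dirichlet_fun lam a s) \<le> D_norm lam k a"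
proof -
  have "bounded (dirichlet_fun lam a ` {s. 1 / real k < Re s})"
    using assms by (simp add: carrier_D_infty_plus)
  then have "bdd_above ((\<lambda>s. cmod (dirichlet_fun lam a s)) ` {s. 1 / real k < Re s})"
    by (auto simp: bounded_iff bdd_above_def)
  then show ?thesis
    unfolding D_norm_def using assms(3) by (intro cSUP_upper) auto
qed

lemma D_norm_le:
  assumes "\<And>s. 1 / real k < Re s \<Longrightarrow> cmod (dirichlet_fun lam a s) \<le> M"
  shows "D_norm lam k a \<le> M"
proof -
  have "of_real (1 / real k + 1) \<in> {s. 1 / real k < Re s}" by simp
  then have "{s. 1 / real k < Re s} \<noteq> {}" by blast
  then show ?thesis unfolding D_norm_def by (rule cSUP_least) (use assms in auto)
qed

lemma D_norm_nonneg:
  assumes "a \<in> carrier (D_infty_plus lam)" "1 \<le> k"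
  shows "0 \<le> D_norm lam k a"
  using norm_dirichlet_fun_le_D_norm[OF assms, of "of_real (1 / real k + 1)"]
  by (auto intro: order_trans[OF norm_ge_zero])

lemma D_norm_mono:
  assumes "a \<in> carrier (D_infty_plus lam)" "1 \<le> j" "j \<le> k"
  shows "D_norm lam j a \<le> D_norm lam k a"
proof (rule D_norm_le)
  fix s assume "1 / real j < Re s"
  moreover have "1 / real k \<le> 1 / real j" using assms by (intro divide_left_mono) auto
  ultimately show "cmod (dirichlet_fun lam a s) \<le> D_norm lam k a"
    using assms by (intro norm_dirichlet_fun_le_D_norm) auto
qed

lemma Re_pos_of_gt_inverse: "1 / real k < Re s \<Longrightarrow> 0 < Re s"
  by (rule le_less_trans[of _ "1 / real k"]) auto

lemma D_norm_triangle:
  assumes a: "a \<in> carrier (D_infty_plus lam)" and b: "b \<in> carrier (D_infty_plus lam)" and k: "1 \<le> k"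
  shows "D_norm lam k (\<lambda>n. a n + b n) \<le> D_norm lam k a + D_norm lam k b"
proof (rule D_norm_le)
  fix s assume s: "1 / real k < Re s"
  then have "dirichlet_fun lam (\<lambda>n. a n + b n) s = dirichlet_fun lam a s + dirichlet_fun lam b s"
    by (intro dirichlet_fun_add a b Re_pos_of_gt_inverse[OF s])
  also have "cmod \<dots> \<le> D_norm lam k a + D_norm lam k b"
    by (intro order_trans[OF norm_triangle_ineq] add_mono norm_dirichlet_fun_le_D_norm a b k s)
  finally show "cmod (dirichlet_fun lam (\<lambda>n. a n + b n) s) \<le> D_norm lam k a + D_norm lam k b" .
qed

lemma D_norm_smult:
  assumes a: "a \<in> carrier (D_infty_plus lam)" and k: "1 \<le> k"
  shows "D_norm lam k (\<lambda>n. c * a n) = cmod c * D_norm lam k a"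
proof -
  have le: "D_norm lam k (\<lambda>n. c * a n) \<le> cmod c * D_norm lam k a"
    if a: "a \<in> carrier (D_infty_plus lam)" for c a
  proof (rule D_norm_le)
    fix s assume s: "1 / real k < Re s"
    show "cmod (dirichlet_fun lam (\<lambda>n. c * a n) s) \<le> cmod c * D_norm lam k a"
      unfolding dirichlet_fun_smult[OF a Re_pos_of_gt_inverse[OF s]] norm_mult
      by (intro mult_left_mono norm_dirichlet_fun_le_D_norm a k s norm_ge_zero)
  qed
  show ?thesis
  proof (cases "c = 0")
    case True
    then show ?thesis
      using le[OF a, of 0] D_norm_nonneg[OF D_infty_plus_zero k] by (auto intro: antisym)
  next
    case False
    have "D_norm lam k (\<lambda>n. inverse c * (c * a n)) \<le> cmod (inverse c) * D_norm lam k (\<lambda>n. c * a n)"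
      by (intro le D_infty_plus_smult_closed a)
    also have "(\<lambda>n. inverse c * (c * a n)) = a" using False by (simp add: fun_eq_iff)
    finally have "cmod c * D_norm lam k a \<le> D_norm lam k (\<lambda>n. c * a n)"
      using False by (simp add: norm_divide field_simps)
    with le[OF a, of c] show ?thesis by (rule antisym)
  qed
qed

lemma seminorm_D_norm:
  assumes "1 \<le> k" shows "seminorm (D_infty_plus lam) (D_norm lam k)"
  using assms by (auto simp: seminorm_def dirichlet_simps D_norm_nonneg D_norm_triangle D_norm_smult)

lemma directed_D_norms: "directed_seminorms (D_infty_plus lam) (D_norms lam)"
  unfolding directed_seminorms_def
proof (intro conjI ballI)
  show "D_norms lam \<noteq> {}" by (auto simp: D_norms_def)
  show "seminorm (D_infty_plus lam) p" if "p \<in> D_norms lam" for p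
    using that by (auto simp: D_norms_def seminorm_D_norm)
  fix p q assume "p \<in> D_norms lam" "q \<in> D_norms lam"
  then obtain i j where ij: "1 \<le> i" "1 \<le> j" "p = D_norm lam i" "q = D_norm lam j"
    by (auto simp: D_norms_def)
  show "\<exists>r\<in>D_norms lam. \<forall>x\<in>carrier (D_infty_plus lam). p x \<le> r x \<and> q x \<le> r x"
    using ij by (intro bexI[of _ "D_norm lam (max i j)"]) (auto simp: D_norms_def D_norm_mono)
qed

lemma norm_dirichlet_term:
  "cmod (dirichlet_term lam a s n) = cmod (a n) * exp (- lam n * Re s)"
  by (simp add: dirichlet_term_def norm_mult)

lemma norm_dirichlet_term_le:
  assumes "0 \<le> lam n" "\<sigma> \<le> Re s"
  shows "cmod (dirichlet_term lam a s n) \<le> cmod (a n) * exp (- lam n * \<sigma>)"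
  unfolding norm_dirichlet_term using assms by (auto intro!: mult_left_mono)

lemma abs_summable_dirichlet:
  assumes nonneg: "\<And>n. 0 \<le> lam n" and sm: "summable (\<lambda>n. cmod (a n) * exp (- lam n * \<sigma>))"
    and s: "\<sigma> \<le> Re s"
  shows "summable (dirichlet_term lam a s)"
    and "cmod (dirichlet_fun lam a s) \<le> (\<Sum>n. cmod (a n) * exp (- lam n * \<sigma>))"
proof -
  have le: "cmod (dirichlet_term lam a s n) \<le> cmod (a n) * exp (- lam n * \<sigma>)" for n
    by (intro norm_dirichlet_term_le nonneg s)
  then have abs: "summable (\<lambda>n. cmod (dirichlet_term lam a s n))"
    by (intro summable_comparison_test'[OF sm]) simp
  then show "summable (dirichlet_term lam a s)" by (rule summable_norm_cancel)
  have "cmod (dirichlet_fun lam a s) \<le> (\<Sum>n. cmod (dirichlet_term lam a s n))"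
    unfolding dirichlet_fun_def by (rule summable_norm[OF abs])
  also have "\<dots> \<le> (\<Sum>n. cmod (a n) * exp (- lam n * \<sigma>))"
    by (intro suminf_le le abs sm)
  finally show "cmod (dirichlet_fun lam a s) \<le> (\<Sum>n. cmod (a n) * exp (- lam n * \<sigma>))" .
qed

text \<open>Weighted absolute summability for all \<open>\<sigma>\<close> is the easy sufficient criterion for membership; it
  covers Dirichlet polynomials for every frequency, and all of the space when \<open>L(\<lambda>) = 0\<close>.\<close>
lemma abs_summable_imp_carrier:
  assumes nonneg: "\<And>n. 0 \<le> lam n"
    and sm: "\<And>\<sigma>. 0 < \<sigma> \<Longrightarrow> summable (\<lambda>n. cmod (a n) * exp (- lam n * \<sigma>))"
  shows "a \<in> carrier (D_infty_plus lam)"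
  unfolding carrier_D_infty_plus bounded_iff
proof (intro conjI allI impI)
  fix \<sigma> :: real assume "0 < \<sigma>"
  then show "\<exists>B. \<forall>z\<in>dirichlet_fun lam a ` {s. \<sigma> < Re s}. cmod z \<le> B"
    using abs_summable_dirichlet(2)[OF nonneg sm] by (auto intro: less_imp_le)
qed (use abs_summable_dirichlet(1)[OF nonneg sm] in auto)

lemma D_norm_le_suminf:
  assumes nonneg: "\<And>n. 0 \<le> lam n" and sm: "summable (\<lambda>n. cmod (a n) * exp (- lam n * (1 / real k)))"
  shows "D_norm lam k a \<le> (\<Sum>n. cmod (a n) * exp (- lam n * (1 / real k)))"
  by (intro D_norm_le abs_summable_dirichlet(2)[OF nonneg sm]) auto

definition monomial :: "nat \<Rightarrow> nat \<Rightarrow> complex" where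
  "monomial n = (\<lambda>j. if j = n then 1 else 0)"

lemma summable_monomial: "summable (\<lambda>j. cmod (monomial n j) * w j)"
  by (rule summable_finite[of "{n}"]) (auto simp: monomial_def)

lemma monomial_in_carrier:
  assumes "\<And>n. 0 \<le> lam n" shows "monomial n \<in> carrier (D_infty_plus lam)"
  by (rule abs_summable_imp_carrier[OF assms summable_monomial])

lemma D_norm_monomial_le:
  assumes "\<And>n. 0 \<le> lam n"
  shows "D_norm lam k (monomial n) \<le> exp (- lam n * (1 / real k))"
proof -
  have "(\<Sum>j. cmod (monomial n j) * exp (- lam j * (1 / real k))) = (\<Sum>j\<in>{n}. cmod (monomial n j) * exp (- lam j * (1 / real k)))"
    by (rule suminf_finite) (auto simp: monomial_def)
  with D_norm_le_suminf[where lam=lam and k=k, OF assms summable_monomial, of n] show ?thesis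
    by (simp add: monomial_def)
qed

lemma dirichlet_fun_polynomial:
  "dirichlet_fun lam (\<lambda>j. \<Sum>n<N. c n * monomial n j) s = (\<Sum>n<N. dirichlet_term lam c s n)"
proof -
  have eq: "(\<Sum>n<N. c n * monomial n j) = (if j < N then c j else 0)" for j
    by (auto simp: monomial_def if_distrib[of "\<lambda>x. c _ * x"] cong: if_cong)
  have "dirichlet_fun lam (\<lambda>j. \<Sum>n<N. c n * monomial n j) s =
      (\<Sum>j<N. dirichlet_term lam (\<lambda>j. \<Sum>n<N. c n * monomial n j) s j)"
    unfolding dirichlet_fun_def by (rule suminf_finite) (auto simp: dirichlet_term_def eq)
  then show ?thesis by (simp add: dirichlet_term_def eq)
qed

lemma riesz_mean_D_norm:
  assumes freq: "frequency lam" and a: "a \<in> carrier (D_infty_plus lam)" and m: "1 \<le> m"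
    and X: "0 < X" "X \<le> lam N" and s: "1 / real m < Re s"
  shows "cmod (\<Sum>n<N. of_real (riesz_weight lam X n) * dirichlet_term lam a s n) \<le> exp 1 * D_norm lam m a"
proof (rule riesz_mean_bound[OF freq X Re_pos_of_gt_inverse[OF s]])
  show "summable (dirichlet_term lam a s)" if "0 < Re s" for s
    using a that by (rule summable_dirichlet_term)
  have "1 / real m < Re (s + Complex 1 u / complex_of_real X)" for u
  proof -
    have "0 < 1 / X" using X by simp
    moreover have "Re (s + Complex 1 u / complex_of_real X) = Re s + 1 / X" by simp
    ultimately show ?thesis using s by linarith
  qed
  then show "cmod (dirichlet_fun lam a (s + Complex 1 u / complex_of_real X)) \<le> D_norm lam m a" for u
    by (intro norm_dirichlet_fun_le_D_norm a m)
qed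

text \<open>For an arbitrary frequency the coefficients are continuous, by induction: the Riesz mean with
  \<open>X = \<lambda>\<^sub>n\<^sub>+\<^sub>1\<close> involves only the coefficients up to index \<open>n\<close>, the last one with positive weight.\<close>
lemma coefficient_continuous:
  assumes freq: "frequency lam" and m: "1 \<le> m"
  shows "\<exists>C. \<forall>a\<in>carrier (D_infty_plus lam). cmod (a n) \<le> C * D_norm lam m a"
proof (induction n rule: less_induct)
  case (less n)
  then obtain C where C: "\<And>i a. i < n \<Longrightarrow> a \<in> carrier (D_infty_plus lam) \<Longrightarrow> cmod (a i) \<le> C i * D_norm lam m a"
    by metis
  define X where "X = lam (Suc n)"
  (* Any point with real part above 1 / m would do. *)
  define s where "s = complex_of_real (2 / real m)"
  define w where "w i = riesz_weight lam X i" for i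
  have lam: "0 \<le> lam i" for i using freq by (simp add: frequency_def)
  have Xn: "lam n < X" using freq by (simp add: frequency_def X_def strict_mono_Suc_iff)
  have X: "0 < X" using lam[of n] Xn by linarith
  have s: "1 / real m < Re s" "Re s = 2 / real m" using m by (simp_all add: s_def field_simps)
  have w0: "0 \<le> w i" for i by (simp add: w_def riesz_weight_def)
  have wn: "0 < w n" using X Xn by (simp add: w_def riesz_weight_def max_def)
  define K where "K = (exp 1 + (\<Sum>i<n. w i * C i)) / (w n * exp (- lam n * Re s))"
  have "cmod (a n) \<le> K * D_norm lam m a" if a: "a \<in> carrier (D_infty_plus lam)" for a
  proof -
    let ?t = "dirichlet_term lam a s"
    have "cmod (a n) * (w n * exp (- lam n * Re s)) = cmod (of_real (w n) * ?t n)"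
      using wn by (simp add: norm_mult norm_dirichlet_term)
    also have "of_real (w n) * ?t n = (\<Sum>i<Suc n. of_real (w i) * ?t i) - (\<Sum>i<n. of_real (w i) * ?t i)"
      by simp
    also have "cmod \<dots> \<le> exp 1 * D_norm lam m a + (\<Sum>i<n. w i * (C i * D_norm lam m a))"
    proof (rule order_trans[OF norm_triangle_ineq4 add_mono])
      show "cmod (\<Sum>i<Suc n. of_real (w i) * ?t i) \<le> exp 1 * D_norm lam m a"
        unfolding w_def by (rule riesz_mean_D_norm[OF freq a m X _ s(1)]) (simp add: X_def)
      have "cmod (\<Sum>i<n. of_real (w i) * ?t i) \<le> (\<Sum>i<n. w i * cmod (?t i))"
        using w0 by (intro order_trans[OF norm_sum]) (simp add: norm_mult)
      also have "\<dots> \<le> (\<Sum>i<n. w i * (C i * D_norm lam m a))"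
      proof (intro sum_mono mult_left_mono w0)
        fix i assume "i \<in> {..<n}"
        then have "cmod (a i) \<le> C i * D_norm lam m a" using C a by auto
        moreover have "cmod (?t i) \<le> cmod (a i)"
          using norm_dirichlet_term_le[where lam=lam and n=i and \<sigma>=0 and s=s and a=a, OF lam] s by simp
        ultimately show "cmod (?t i) \<le> C i * D_norm lam m a" by simp
      qed
      finally show "cmod (\<Sum>i<n. of_real (w i) * ?t i) \<le> (\<Sum>i<n. w i * (C i * D_norm lam m a))" .
    qed
    also have "\<dots> = (exp 1 + (\<Sum>i<n. w i * C i)) * D_norm lam m a"
      by (simp add: algebra_simps sum_distrib_left)
    finally show ?thesis using wn by (simp add: K_def field_simps)
  qed
  then show ?case by blast
qed

lemma D_norm_eq_0_iff:
  assumes freq: "frequency lam" and k: "1 \<le> k" and a: "a \<in> carrier (D_infty_plus lam)"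
  shows "D_norm lam k a = 0 \<longleftrightarrow> a = (\<lambda>n. 0)"
proof
  assume 0: "D_norm lam k a = 0"
  show "a = (\<lambda>n. 0)"
  proof
    fix n
    obtain C where "cmod (a n) \<le> C * D_norm lam k a"
      using coefficient_continuous[OF freq k, of n] a by blast
    with 0 show "a n = 0" by simp
  qed
next
  assume "a = (\<lambda>n. 0)"
  then show "D_norm lam k a = 0" using D_norm_smult[OF a k, of 0] by simp
qed

lemma seminorm_kernel_D_norm:
  assumes "frequency lam" "1 \<le> k"
  shows "seminorm_kernel (D_infty_plus lam) (D_norm lam k) = {\<zero>\<^bsub>D_infty_plus lam\<^esub>}"
  using D_norm_eq_0_iff[OF assms] D_infty_plus_zero[of lam] unfolding seminorm_kernel_def dirichlet_simps
  by auto

lemma D_norm_monomial_pos: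
  assumes freq: "frequency lam" and k: "1 \<le> k"
  shows "0 < D_norm lam k (monomial n)"
proof -
  have m: "monomial n \<in> carrier (D_infty_plus lam)"
    using freq by (intro monomial_in_carrier) (simp add: frequency_def)
  have "monomial n \<noteq> (\<lambda>j. 0)" by (auto simp: monomial_def fun_eq_iff)
  then have "D_norm lam k (monomial n) \<noteq> 0" using D_norm_eq_0_iff[OF freq k m] by simp
  with D_norm_nonneg[OF m k] show ?thesis by linarith
qed

section \<open>The growth of a frequency\<close>

lemma frequency_eventually_ge:
  assumes "frequency lam"
  shows "\<forall>\<^sub>F n in sequentially. B \<le> lam n"
proof -
  obtain N where "B < lam N"
    using assms by (auto simp: frequency_def bdd_above_def not_le)
  moreover have "lam N \<le> lam n" if "N \<le> n" for n
    using assms that by (auto simp: frequency_def dest: strict_mono_mono monoD)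
  ultimately show ?thesis
    by (intro eventually_sequentiallyI[of N]) (meson less_imp_le order_trans)
qed

lemma L_freq_eq_0_iff:
  assumes freq: "frequency lam"
  shows "L_freq lam = 0 \<longleftrightarrow> (\<forall>\<epsilon>>0. \<forall>\<^sub>F n in sequentially. ln (real (n + 1)) \<le> \<epsilon> * lam n)"
proof
  assume L: "L_freq lam = 0"
  show "\<forall>\<epsilon>>0. \<forall>\<^sub>F n in sequentially. ln (real (n + 1)) \<le> \<epsilon> * lam n"
  proof (intro allI impI)
    fix \<epsilon> :: real assume "0 < \<epsilon>"
    with L have "limsup (\<lambda>n. ereal (ln (real (n + 1)) / lam n)) < ereal \<epsilon>"
      by (simp add: L_freq_def)
    then have "\<forall>\<^sub>F n in sequentially. ereal (ln (real (n + 1)) / lam n) < ereal \<epsilon>"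
      by (rule Limsup_lessD)
    with frequency_eventually_ge[OF freq, of 1]
    show "\<forall>\<^sub>F n in sequentially. ln (real (n + 1)) \<le> \<epsilon> * lam n"
      by eventually_elim (simp add: field_simps)
  qed
next
  assume *: "\<forall>\<epsilon>>0. \<forall>\<^sub>F n in sequentially. ln (real (n + 1)) \<le> \<epsilon> * lam n"
  have "(\<lambda>n. ln (real (n + 1)) / lam n) \<longlonglongrightarrow> 0"
  proof (rule tendstoI)
    fix e :: real assume e: "0 < e"
    then have "\<forall>\<^sub>F n in sequentially. ln (real (n + 1)) \<le> e / 2 * lam n" using *[rule_format, of "e / 2"] by simp
    with frequency_eventually_ge[OF freq, of 1]
    show "\<forall>\<^sub>F n in sequentially. dist (ln (real (n + 1)) / lam n) 0 < e"
    proof eventually_elim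
      case (elim n)
      have "ln (real (n + 1)) / lam n \<le> e / 2" using elim by (simp add: field_simps)
      moreover have "0 \<le> ln (real (n + 1)) / lam n" using elim by (intro divide_nonneg_nonneg) auto
      ultimately show ?case using e unfolding dist_real_def by linarith
    qed
  qed
  then show "L_freq lam = 0"
    unfolding L_freq_def by (intro lim_imp_Limsup) (simp_all add: zero_ereal_def)
qed

section \<open>Nuclearity bounds the growth\<close>

lemma dual_space_polynomial:
  assumes lam: "\<And>n. 0 \<le> lam n" and f: "f \<in> dual_space (D_infty_plus lam) p"
  shows "f (\<lambda>j. \<Sum>n<N. c n * monomial n j) = (\<Sum>n<N. c n * f (monomial n))"
proof (induction N)
  case 0
  have "f (0 \<odot>\<^bsub>D_infty_plus lam\<^esub> (\<lambda>n. 0)) = 0 * f (\<lambda>n. 0)"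
    using f D_infty_plus_zero[of lam] unfolding dual_space_def by blast
  then show ?case by (simp add: dirichlet_simps)
next
  case (Suc N)
  have m: "monomial n \<in> carrier (D_infty_plus lam)" for n by (rule monomial_in_carrier[OF lam])
  have cm: "(\<lambda>j. c n * monomial n j) \<in> carrier (D_infty_plus lam)" for n
    by (intro D_infty_plus_smult_closed m)
  have pm: "(\<lambda>j. \<Sum>n<N. c n * monomial n j) \<in> carrier (D_infty_plus lam)"
    by (intro D_infty_plus_sum_closed cm) simp
  have "f ((\<lambda>j. \<Sum>n<N. c n * monomial n j) \<oplus>\<^bsub>D_infty_plus lam\<^esub> (c N \<odot>\<^bsub>D_infty_plus lam\<^esub> monomial N)) =
      f (\<lambda>j. \<Sum>n<N. c n * monomial n j) + c N * f (monomial N)"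
    using f pm cm[of N] m[of N] by (simp add: dual_space_def dirichlet_simps)
  then show ?case by (simp add: dirichlet_simps Suc)
qed

text \<open>The weights \<open>exp(-\<lambda>\<^sub>n/m)\<close> shift the argument by \<open>1/m\<close> into the half-plane that \<open>\<parallel>\<cdot>\<parallel>\<^sub>m\<close> controls.
  Hence the bound is the same for every norm index \<open>k\<close> on the left.\<close>
lemma D_norm_riesz_polynomial:
  assumes freq: "frequency lam" and a: "a \<in> carrier (D_infty_plus lam)" and m: "1 \<le> m"
    and X: "0 < X" "X \<le> lam N"
  shows "D_norm lam k (\<lambda>j. \<Sum>n<N. of_real (riesz_weight lam X n * exp (- lam n / real m)) * a n * monomial n j)
    \<le> exp 1 * D_norm lam m a"
proof (rule D_norm_le)
  fix s assume s: "1 / real k < Re s"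
  let ?s = "s + of_real (1 / real m)"
  have s': "1 / real m < Re ?s" using Re_pos_of_gt_inverse[OF s] by simp
  have "dirichlet_term lam (\<lambda>n. of_real (riesz_weight lam X n * exp (- lam n / real m)) * a n) s n
      = of_real (riesz_weight lam X n) * dirichlet_term lam a ?s n" for n
    unfolding dirichlet_term_add by (simp add: dirichlet_term_def exp_of_real[symmetric])
  then show "cmod (dirichlet_fun lam (\<lambda>j. \<Sum>n<N. of_real (riesz_weight lam X n * exp (- lam n / real m)) * a n * monomial n j) s)
      \<le> exp 1 * D_norm lam m a"
    unfolding dirichlet_fun_polynomial using riesz_mean_D_norm[OF freq a m X s'] by simp
qed

text \<open>The trace of the diagonal operator \<open>e\<^sub>n \<mapsto> v\<^sub>n e\<^sub>n\<close>, computed from a nuclear representation of the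
  identity. The operator has finite rank, so the two summations can be interchanged; uniformity in
  \<open>X\<close> comes from the uniform bound on the Riesz means.\<close>
lemma nuclear_imp_weighted_trace_bounded:
  assumes freq: "frequency lam" and nuc: "nuclear_space (D_infty_plus lam) (D_norms lam)" and m: "1 \<le> m"
  shows "\<exists>C. \<forall>X N. 0 < X \<longrightarrow> X \<le> lam N \<longrightarrow> (\<Sum>n<N. riesz_weight lam X n * exp (- lam n / real m)) \<le> C"
proof -
  let ?E = "D_infty_plus lam"
  have lam: "0 \<le> lam n" for n using freq by (simp add: frequency_def)
  have "D_norm lam m \<in> D_norms lam" using m by (auto simp: D_norms_def)
  then obtain p where p: "p \<in> D_norms lam"
    and op: "nuclear_operator (local_space ?E p) (local_norm p) (local_space ?E (D_norm lam m))
        (local_norm (D_norm lam m)) (canonical_map ?E (D_norm lam m))"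
    using nuc unfolding nuclear_space_def by blast
  from p obtain k where k: "1 \<le> k" "p = D_norm lam k" by (auto simp: D_norms_def)
  obtain g z where g: "\<And>j. g j \<in> dual_space ?E p" and z: "\<And>j. z j \<in> carrier ?E"
    and sm: "summable (\<lambda>j. dual_norm ?E p (g j) * D_norm lam m (z j))"
    and lim: "\<And>x. x \<in> carrier ?E \<Longrightarrow>
        (\<lambda>J. D_norm lam m (x \<ominus>\<^bsub>?E\<^esub> (\<Oplus>\<^bsub>?E\<^esub>j\<in>{..<J}. g j x \<odot>\<^bsub>?E\<^esub> z j))) \<longlonglongrightarrow> 0"
    using op unfolding k(2) nuclear_canonical_map_iff[OF complex_vector_space_D_infty_plus
        seminorm_kernel_D_norm[OF freq k(1)] seminorm_kernel_D_norm[OF freq m]]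
    by blast
  have sem: "seminorm ?E p" unfolding k(2) by (rule seminorm_D_norm[OF k(1)])
  have mono_in: "monomial n \<in> carrier ?E" for n by (rule monomial_in_carrier[OF lam])
  (* Coefficients are continuous, so the representation may be read off coefficientwise. *)
  have trace: "(\<lambda>j. g j (monomial n) * z j n) sums 1" for n
  proof -
    obtain C where C: "\<And>a. a \<in> carrier ?E \<Longrightarrow> cmod (a n) \<le> C * D_norm lam m a"
      using coefficient_continuous[OF freq m] by blast
    define R where "R J = (\<lambda>i. monomial n i - (\<Sum>j<J. g j (monomial n) * z j i))" for J
    have gz: "(\<lambda>i. g j (monomial n) * z j i) \<in> carrier ?E" for j by (intro D_infty_plus_smult_closed z)
    have sum_in: "(\<lambda>i. \<Sum>j<J. g j (monomial n) * z j i) \<in> carrier ?E" for J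
      by (intro D_infty_plus_sum_closed gz) simp
    have R: "R J \<in> carrier ?E" for J
      unfolding R_def by (intro D_infty_plus_diff_closed mono_in sum_in)
    have "monomial n \<ominus>\<^bsub>?E\<^esub> (\<Oplus>\<^bsub>?E\<^esub>j\<in>{..<J}. g j (monomial n) \<odot>\<^bsub>?E\<^esub> z j) = R J" for J
      using sum_in gz by (simp add: D_infty_plus_finsum dirichlet_simps(3) D_infty_plus_diff mono_in R_def)
    with lim[OF mono_in[of n]] have "(\<lambda>J. D_norm lam m (R J)) \<longlonglongrightarrow> 0" by simp
    then have "(\<lambda>J. C * D_norm lam m (R J)) \<longlonglongrightarrow> 0" by (rule tendsto_mult_right_zero)
    then have "(\<lambda>J. R J n) \<longlonglongrightarrow> 0"
      by (rule Lim_null_comparison[rotated]) (use C[OF R] in simp)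
    then have "(\<lambda>J. 1 - R J n) \<longlonglongrightarrow> 1 - 0" by (intro tendsto_intros)
    then show ?thesis by (simp add: R_def sums_def monomial_def)
  qed
  show ?thesis
  proof (intro exI allI impI)
    fix X :: real and N assume X: "0 < X" "X \<le> lam N"
    define v where "v n = riesz_weight lam X n * exp (- lam n / real m)" for n
    define h where "h j = (\<lambda>i. \<Sum>n<N. of_real (v n) * z j n * monomial n i)" for j
    have h: "h j \<in> carrier ?E" for j
      unfolding h_def by (intro D_infty_plus_sum_closed D_infty_plus_smult_closed mono_in) simp
    have gh: "g j (h j) = (\<Sum>n<N. of_real (v n) * (g j (monomial n) * z j n))" for j
      unfolding h_def using dual_space_polynomial[where lam=lam and c="\<lambda>n. of_real (v n) * z j n", OF lam g] by (simp add: mult_ac)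
    have "(\<lambda>j. g j (h j)) sums (\<Sum>n<N. of_real (v n) * 1)"
      unfolding gh by (intro sums_sum sums_mult trace)
    then have sums: "(\<lambda>j. g j (h j)) sums of_real (\<Sum>n<N. v n)" by simp
    have bound: "cmod (g j (h j)) \<le> exp 1 * (dual_norm ?E p (g j) * D_norm lam m (z j))" for j
    proof -
      have dn: "0 \<le> dual_norm ?E p (g j)"
        by (rule dual_norm_nonneg[OF complex_vector_space_D_infty_plus sem g mono_in[of 0]])
           (simp add: k(2) D_norm_monomial_pos[OF freq k(1)])
      have "cmod (g j (h j)) \<le> dual_norm ?E p (g j) * p (h j)"
        by (intro norm_le_dual_norm complex_vector_space_D_infty_plus sem g h)
      also have "\<dots> \<le> dual_norm ?E p (g j) * (exp 1 * D_norm lam m (z j))"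
        unfolding k(2) h_def v_def by (intro mult_left_mono D_norm_riesz_polynomial freq z m X dn[unfolded k(2)])
      finally show ?thesis by (simp add: mult_ac)
    qed
    have "cmod (of_real (\<Sum>n<N. v n)) \<le> (\<Sum>j. exp 1 * (dual_norm ?E p (g j) * D_norm lam m (z j)))"
      unfolding sums_unique[OF sums] by (rule norm_suminf_le[OF bound]) (intro summable_mult sm)
    then show "(\<Sum>n<N. riesz_weight lam X n * exp (- lam n / real m)) \<le>
        (\<Sum>j. exp 1 * (dual_norm ?E p (g j) * D_norm lam m (z j)))"
      unfolding v_def[symmetric] by (simp del: of_real_sum)
  qed
qed

text \<open>For \<open>X \<ge> 2 \<lambda>\<^sub>N\<close> all weights with index below \<open>N\<close> are at least \<open>1/4\<close>.\<close>
lemma nuclear_imp_exp_sums_bounded: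
  assumes freq: "frequency lam" and nuc: "nuclear_space (D_infty_plus lam) (D_norms lam)" and m: "1 \<le> m"
  shows "\<exists>C. \<forall>N. (\<Sum>n<N. exp (- lam n / real m)) \<le> C"
proof -
  obtain C where C: "\<And>X N. 0 < X \<Longrightarrow> X \<le> lam N \<Longrightarrow> (\<Sum>n<N. riesz_weight lam X n * exp (- lam n / real m)) \<le> C"
    using nuclear_imp_weighted_trace_bounded[OF assms] by blast
  have lam: "mono lam" "\<And>n. 0 \<le> lam n" using freq by (auto simp: frequency_def strict_mono_mono)
  have "(\<Sum>n<N. exp (- lam n / real m)) \<le> 4 * C" for N
  proof -
    (* The summand 1 keeps X positive when the frequency starts with 0. *)
    define X where "X = 2 * lam N + 1"
    have X: "0 < X" using lam(2)[of N] by (simp add: X_def)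
    obtain N' where N': "X \<le> lam N'" "N \<le> N'"
      using eventually_conj[OF frequency_eventually_ge[OF freq, of X] eventually_ge_at_top[of N]]
      by (auto simp: eventually_sequentially)
    have w: "1 / 4 \<le> riesz_weight lam X n" if "n < N" for n
    proof -
      have "lam n \<le> lam N" using monoD[OF lam(1), of n N] that by simp
      then have "lam n / X \<le> 1 / 2" using X by (simp add: X_def field_simps)
      then have "1 / 2 \<le> max 0 (1 - lam n / X)" by linarith
      then have "(1 / 2)\<^sup>2 \<le> (max 0 (1 - lam n / X))\<^sup>2" by (rule power_mono) simp
      then show ?thesis by (simp add: riesz_weight_def power2_eq_square)
    qed
    have "(\<Sum>n<N. exp (- lam n / real m)) = 4 * (\<Sum>n<N. 1 / 4 * exp (- lam n / real m))"
      by (simp add: sum_distrib_left)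
    also have "\<dots> \<le> 4 * (\<Sum>n<N. riesz_weight lam X n * exp (- lam n / real m))"
      using w by (intro mult_left_mono sum_mono mult_right_mono) auto
    also have "\<dots> \<le> 4 * (\<Sum>n<N'. riesz_weight lam X n * exp (- lam n / real m))"
      using N'(2) by (intro mult_left_mono sum_mono2) (auto simp: riesz_weight_def)
    also have "\<dots> \<le> 4 * C" using C[OF X N'(1)] by simp
    finally show ?thesis .
  qed
  then show ?thesis by blast
qed

lemma nuclear_imp_L_freq_eq_0:
  assumes freq: "frequency lam" and nuc: "nuclear_space (D_infty_plus lam) (D_norms lam)"
  shows "L_freq lam = 0"
  unfolding L_freq_eq_0_iff[OF freq]
proof (intro allI impI)
  fix \<epsilon> :: real assume \<epsilon>: "0 < \<epsilon>"
  have lam: "mono lam" using freq by (auto simp: frequency_def strict_mono_mono)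
  obtain m :: nat where m: "2 / \<epsilon> < real m" using reals_Archimedean2 by blast
  then have m1: "1 \<le> m" using \<epsilon> by (cases m) (auto simp: field_simps)
  obtain C where C: "\<And>N. (\<Sum>n<N. exp (- lam n / real m)) \<le> C"
    using nuclear_imp_exp_sums_bounded[OF assms m1] by blast
  show "\<forall>\<^sub>F n in sequentially. ln (real (n + 1)) \<le> \<epsilon> * lam n"
    using frequency_eventually_ge[OF freq, of "2 * ln C / \<epsilon>"] frequency_eventually_ge[OF freq, of 0]
  proof eventually_elim
    case (elim n)
    have "real (n + 1) * exp (- lam n / real m) = (\<Sum>i<Suc n. exp (- lam n / real m))" by simp
    also have "\<dots> \<le> (\<Sum>i<Suc n. exp (- lam i / real m))"
      by (intro sum_mono) (auto intro!: divide_right_mono monoD[OF lam])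
    also have "\<dots> \<le> C" by (rule C)
    finally have le: "real (n + 1) * exp (- lam n / real m) \<le> C" .
    have "ln (real (n + 1)) - lam n / real m = ln (real (n + 1) * exp (- lam n / real m))"
      by (subst ln_mult) auto
    also have "\<dots> \<le> ln C"
      by (rule ln_mono[OF le]) simp
    also have "\<dots> \<le> \<epsilon> / 2 * lam n" using elim(1) \<epsilon> by (simp add: field_simps)
    finally have "ln (real (n + 1)) \<le> \<epsilon> / 2 * lam n + 1 / real m * lam n" by simp
    also have "\<dots> \<le> \<epsilon> / 2 * lam n + \<epsilon> / 2 * lam n"
      using m m1 \<epsilon> elim(2) by (intro add_left_mono mult_right_mono) (auto simp: field_simps)
    finally show ?case by simp
  qed
qed

section \<open>Absolute convergence and coefficient bounds\<close>

text \<open>Here \<open>log (n+1) \<le> \<sigma>\<lambda>\<^sub>n/2\<close> eventually, so the terms are dominated by \<open>(n+1)\<^sup>-\<^sup>2\<close>.\<close>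
lemma summable_exp_of_L_freq_0:
  assumes freq: "frequency lam" and L: "L_freq lam = 0" and \<sigma>: "0 < \<sigma>"
  shows "summable (\<lambda>n. exp (- lam n * \<sigma>))"
proof (rule summable_comparison_test_ev)
  have "\<forall>\<^sub>F n in sequentially. ln (real (n + 1)) \<le> \<sigma> / 2 * lam n"
    using L \<sigma> unfolding L_freq_eq_0_iff[OF freq] by (elim allE[of _ "\<sigma> / 2"]) simp
  then show "\<forall>\<^sub>F n in sequentially. norm (exp (- lam n * \<sigma>)) \<le> inverse (real (Suc n) ^ 2)"
  proof eventually_elim
    case (elim n)
    have "exp (- lam n * \<sigma>) \<le> exp (- (2 * ln (real (Suc n))))" using elim by (simp add: mult.commute)
    also have "\<dots> = inverse (real (Suc n) ^ 2)"
      by (simp add: exp_minus exp_double)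
    finally show ?case by simp
  qed
  show "summable (\<lambda>n. inverse (real (Suc n) ^ 2))"
    using inverse_power_summable[of 2, where ?'a = real] by (subst summable_Suc_iff) simp
qed

text \<open>Convergence at \<open>\<sigma>/2\<close> bounds the terms there; the remaining factor \<open>exp(-\<lambda>\<^sub>n \<sigma>/2)\<close> is summable.\<close>
lemma abs_summable_of_L_freq_0:
  assumes freq: "frequency lam" and L: "L_freq lam = 0" and a: "a \<in> carrier (D_infty_plus lam)" and \<sigma>: "0 < \<sigma>"
  shows "summable (\<lambda>n. cmod (a n) * exp (- lam n * \<sigma>))"
proof -
  have "(\<lambda>n. dirichlet_term lam a (of_real (\<sigma> / 2)) n) \<longlonglongrightarrow> 0"
    using \<sigma> by (intro summable_LIMSEQ_zero summable_dirichlet_term[OF a]) simp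
  then have "Bseq (\<lambda>n. dirichlet_term lam a (of_real (\<sigma> / 2)) n)"
    using convergent_imp_Bseq convergent_def by blast
  then obtain B where B: "\<And>n. cmod (dirichlet_term lam a (of_real (\<sigma> / 2)) n) \<le> B"
    by (auto simp: Bseq_def)
  show ?thesis
  proof (rule summable_comparison_test')
    show "summable (\<lambda>n. B * exp (- lam n * (\<sigma> / 2)))"
      using \<sigma> by (intro summable_mult summable_exp_of_L_freq_0[OF freq L]) simp
    fix n
    have "exp (- lam n * \<sigma>) = exp (- lam n * (\<sigma> / 2)) * exp (- lam n * (\<sigma> / 2))"
      by (simp flip: exp_add)
    then have "cmod (a n) * exp (- lam n * \<sigma>) = cmod (dirichlet_term lam a (of_real (\<sigma> / 2)) n) * exp (- lam n * (\<sigma> / 2))"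
      by (simp add: norm_dirichlet_term)
    also have "\<dots> \<le> B * exp (- lam n * (\<sigma> / 2))" using B by (intro mult_right_mono) auto
    finally show "norm (cmod (a n) * exp (- lam n * \<sigma>)) \<le> B * exp (- lam n * (\<sigma> / 2))" by simp
  qed
qed

lemma mean_of_powers_tendsto_0:
  fixes z :: complex
  assumes "cmod z = 1" "z \<noteq> 1"
  shows "(\<lambda>K. (\<Sum>j<K. z ^ j) / of_nat K) \<longlonglongrightarrow> 0"
proof (rule Lim_null_comparison)
  show "\<forall>\<^sub>F K in sequentially. cmod ((\<Sum>j<K. z ^ j) / of_nat K) \<le> 2 / cmod (1 - z) * (1 / real K)"
  proof (rule always_eventually, rule allI)
    fix K
    have "cmod (\<Sum>j<K. z ^ j) = cmod (1 - z ^ K) / cmod (1 - z)"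
      using assms by (simp add: sum_gp_strict norm_divide)
    also have "\<dots> \<le> 2 / cmod (1 - z)"
      using norm_triangle_ineq4[of 1 "z ^ K"] assms by (intro divide_right_mono) (simp_all add: norm_power)
    finally have "cmod (\<Sum>j<K. z ^ j) * (1 / real K) \<le> 2 / cmod (1 - z) * (1 / real K)"
      by (intro mult_right_mono) auto
    then show "cmod ((\<Sum>j<K. z ^ j) / of_nat K) \<le> 2 / cmod (1 - z) * (1 / real K)"
      by (simp add: norm_divide)
  qed
  show "(\<lambda>K. 2 / cmod (1 - z) * (1 / real K)) \<longlonglongrightarrow> 0"
    by (intro tendsto_mult_right_zero lim_1_over_n)
qed

text \<open>A discrete form of Bohr's mean value: sampling at the points \<open>j\<tau>\<close> replaces integrals by geometric
  sums. The step \<open>\<tau>\<close> is so small that the finitely many frequencies stay distinct modulo \<open>2\<pi>/\<tau>\<close>.\<close>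
lemma exponential_polynomial_coefficient_bound:
  fixes c :: "nat \<Rightarrow> complex" and lam :: "nat \<Rightarrow> real"
  assumes inj: "inj_on lam {..<N}" and n: "n < N"
    and M: "\<And>t. cmod (\<Sum>i<N. c i * cis (- lam i * t)) \<le> M"
  shows "cmod (c n) \<le> M"
proof -
  define B where "B = Max ((\<lambda>i. \<bar>lam n - lam i\<bar>) ` {..<N})"
  have B: "\<bar>lam n - lam i\<bar> \<le> B" if "i < N" for i
    unfolding B_def using that by (intro Max_ge) auto
  have B0: "0 \<le> B" using B[OF n] by simp
  (* All phases (lam n - lam i) * tau then lie strictly between -1 and 1. *)
  define \<tau> where "\<tau> = 1 / (B + 1)"
  have \<tau>: "0 < \<tau>" using B0 by (simp add: \<tau>_def)
  define z where "z i = cis ((lam n - lam i) * \<tau>)" for i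
  have z: "z i \<noteq> 1" if i: "i < N" "i \<noteq> n" for i
  proof
    assume "z i = 1"
    then have sin0: "sin ((lam n - lam i) * \<tau>) = 0" by (simp add: z_def complex_eq_iff)
    have small: "\<bar>(lam n - lam i) * \<tau>\<bar> < pi"
    proof -
      have "\<bar>(lam n - lam i) * \<tau>\<bar> \<le> B * \<tau>"
        unfolding abs_mult using B[OF i(1)] \<tau> by simp
      also have "\<dots> < 1" using B0 by (simp add: \<tau>_def)
      also have "1 < pi" using pi_gt3 by simp
      finally show ?thesis .
    qed
    have "(lam n - lam i) * \<tau> = 0"
      by (rule sin_eq_0_pi[OF _ _ sin0]) (use small in \<open>simp_all only: abs_less_iff minus_less_iff\<close>)
    then show False using \<tau> inj i n by (auto simp: inj_on_def)
  qed
  have mean: "(\<Sum>j<K. (\<Sum>i<N. c i * cis (- lam i * (real j * \<tau>))) * cis (lam n * (real j * \<tau>))) / of_nat K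
      = (\<Sum>i<N. c i * ((\<Sum>j<K. z i ^ j) / of_nat K))" for K
  proof -
    have "cis (- lam i * (real j * \<tau>)) * cis (lam n * (real j * \<tau>)) = z i ^ j" for i j
    proof -
      have "- lam i * (real j * \<tau>) + lam n * (real j * \<tau>) = real j * ((lam n - lam i) * \<tau>)"
        by (simp add: algebra_simps)
      then show ?thesis by (simp only: z_def Complex.DeMoivre cis_mult)
    qed
    then show ?thesis
      by (simp add: sum_distrib_right sum_distrib_left sum_divide_distrib mult.assoc)
         (rule sum.swap)
  qed
  have "(\<lambda>K. \<Sum>i<N. c i * ((\<Sum>j<K. z i ^ j) / of_nat K)) \<longlonglongrightarrow> (\<Sum>i<N. c i * (if i = n then 1 else 0))"
  proof (intro tendsto_sum tendsto_mult tendsto_const)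
    fix i assume i: "i \<in> {..<N}"
    show "(\<lambda>K. (\<Sum>j<K. z i ^ j) / of_nat K) \<longlonglongrightarrow> (if i = n then 1 else 0)"
    proof (cases "i = n")
      case True
      have "(\<Sum>j<K. z i ^ j) / of_nat K = 1" if "1 \<le> K" for K
        using that True by (simp add: z_def)
      then have "\<forall>\<^sub>F K in sequentially. (\<Sum>j<K. z i ^ j) / of_nat K = 1"
        by (intro eventually_sequentiallyI[of 1]) blast
      with True show ?thesis by (simp add: tendsto_eventually)
    next
      case False
      with i show ?thesis using mean_of_powers_tendsto_0[of "z i"] z[of i] by (simp add: z_def)
    qed
  qed
  moreover have "(\<Sum>i<N. c i * (if i = n then 1 else 0)) = c n"
    using n by (simp add: if_distrib[of "\<lambda>x. c _ * x"] cong: if_cong)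
  ultimately have lim: "(\<lambda>K. \<Sum>i<N. c i * ((\<Sum>j<K. z i ^ j) / of_nat K)) \<longlonglongrightarrow> c n"
    by simp
  have "cmod (\<Sum>i<N. c i * ((\<Sum>j<K. z i ^ j) / of_nat K)) \<le> M" if K: "1 \<le> K" for K
  proof -
    have "cmod (\<Sum>j<K. (\<Sum>i<N. c i * cis (- lam i * (real j * \<tau>))) * cis (lam n * (real j * \<tau>))) \<le> (\<Sum>j<K. M)"
      using M by (intro sum_norm_le) (simp add: norm_mult)
    then show ?thesis
      using K unfolding mean[symmetric] norm_divide norm_of_nat sum_constant card_lessThan
      by (simp add: pos_divide_le_eq mult.commute)
  qed
  then have "\<forall>\<^sub>F K in sequentially. cmod (\<Sum>i<N. c i * ((\<Sum>j<K. z i ^ j) / of_nat K)) \<le> M"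
    by (intro eventually_sequentiallyI[of 1]) blast
  then show ?thesis by (intro Lim_norm_ubound[OF _ lim]) auto
qed

text \<open>On the line \<open>Re s = \<sigma>\<close> the tail of the series is uniformly small, so that a long partial sum, an
  exponential polynomial in \<open>Im s\<close>, is bounded by \<open>\<parallel>D\<parallel>\<^sub>k\<close> up to an arbitrarily small error.\<close>
lemma cauchy_coefficient_bound:
  assumes freq: "frequency lam" and L: "L_freq lam = 0" and a: "a \<in> carrier (D_infty_plus lam)"
    and k: "1 \<le> k" and \<sigma>: "1 / real k < \<sigma>"
  shows "cmod (a n) \<le> exp (lam n * \<sigma>) * D_norm lam k a"
proof -
  have \<sigma>0: "0 < \<sigma>" using Re_pos_of_gt_inverse[of k "of_real \<sigma>"] \<sigma> by simp
  have sm: "summable (\<lambda>n. cmod (a n) * exp (- lam n * \<sigma>))"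
    by (rule abs_summable_of_L_freq_0[OF freq L a \<sigma>0])
  define c where "c i = a i * of_real (exp (- lam i * \<sigma>))" for i
  have trm: "dirichlet_term lam a (Complex \<sigma> t) i = c i * cis (- lam i * t)" for t i
  proof -
    have "- complex_of_real (lam i) * Complex \<sigma> t = of_real (- lam i * \<sigma>) + \<i> * of_real (- lam i * t)"
      by (simp add: complex_eq_iff)
    then have "exp (- complex_of_real (lam i) * Complex \<sigma> t) = of_real (exp (- lam i * \<sigma>)) * cis (- lam i * t)"
      by (simp only: exp_add exp_of_real cis_conv_exp)
    then show ?thesis by (simp add: dirichlet_term_def c_def)
  qed
  have "cmod (c n) \<le> D_norm lam k a"
  proof (rule field_le_epsilon)
    fix e :: real assume e: "0 < e"
    obtain N where N: "n < N" "(\<Sum>i. cmod (a (i + N)) * exp (- lam (i + N) * \<sigma>)) < e"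
    proof -
      obtain N0 where N0: "\<And>N. N \<ge> N0 \<Longrightarrow> norm (\<Sum>i. cmod (a (i + N)) * exp (- lam (i + N) * \<sigma>)) < e"
        using suminf_exist_split[OF e sm] by blast
      show thesis
      proof (rule that)
        show "n < max N0 (Suc n)" by simp
        show "(\<Sum>i. cmod (a (i + max N0 (Suc n))) * exp (- lam (i + max N0 (Suc n)) * \<sigma>)) < e"
          using N0[of "max N0 (Suc n)"] unfolding real_norm_def by linarith
      qed
    qed
    show "cmod (c n) \<le> D_norm lam k a + e"
    proof (rule exponential_polynomial_coefficient_bound[where lam=lam])
      show "inj_on lam {..<N}" using freq by (auto simp: frequency_def intro: inj_on_subset strict_mono_imp_inj_on)
      show "n < N" by (rule N)
      fix t
      let ?s = "Complex \<sigma> t"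
      have sm': "summable (dirichlet_term lam a ?s)" using \<sigma>0 by (intro summable_dirichlet_term[OF a]) simp
      have "dirichlet_fun lam a ?s = (\<Sum>i. dirichlet_term lam a ?s (i + N)) + (\<Sum>i<N. c i * cis (- lam i * t))"
        unfolding dirichlet_fun_def suminf_split_initial_segment[OF sm', of N] by (simp add: trm)
      then have "(\<Sum>i<N. c i * cis (- lam i * t)) = dirichlet_fun lam a ?s - (\<Sum>i. dirichlet_term lam a ?s (i + N))"
        by simp
      also have "cmod \<dots> \<le> D_norm lam k a + e"
      proof (rule order_trans[OF norm_triangle_ineq4 add_mono])
        show "cmod (dirichlet_fun lam a ?s) \<le> D_norm lam k a"
          using \<sigma> by (intro norm_dirichlet_fun_le_D_norm a k) simp
        have "cmod (\<Sum>i. dirichlet_term lam a ?s (i + N)) \<le> (\<Sum>i. cmod (a (i + N)) * exp (- lam (i + N) * \<sigma>))"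
        proof (rule norm_suminf_le)
          show "summable (\<lambda>i. cmod (a (i + N)) * exp (- lam (i + N) * \<sigma>))"
            by (rule summable_ignore_initial_segment[OF sm])
        qed (simp add: norm_dirichlet_term)
        then show "cmod (\<Sum>i. dirichlet_term lam a ?s (i + N)) \<le> e" using N(2) by simp
      qed
      finally show "cmod (\<Sum>i<N. c i * cis (- lam i * t)) \<le> D_norm lam k a + e" .
    qed
  qed
  then have "exp (lam n * \<sigma>) * (cmod (a n) * exp (- lam n * \<sigma>)) \<le> exp (lam n * \<sigma>) * D_norm lam k a"
    by (intro mult_left_mono) (simp_all add: c_def norm_mult)
  also have "exp (lam n * \<sigma>) * (cmod (a n) * exp (- lam n * \<sigma>)) = cmod (a n) * exp (lam n * \<sigma> + - lam n * \<sigma>)"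
    unfolding exp_add by (simp add: mult_ac)
  finally show ?thesis by simp
qed

section \<open>Nuclearity and completeness under slow growth\<close>

lemma monomial_expansion:
  assumes freq: "frequency lam" and L: "L_freq lam = 0" and m: "1 \<le> m" and a: "a \<in> carrier (D_infty_plus lam)"
  shows "(\<lambda>J. D_norm lam m (\<lambda>i. a i - (\<Sum>n<J. a n * monomial n i))) \<longlonglongrightarrow> 0"
proof -
  have lam: "0 \<le> lam n" for n using freq by (simp add: frequency_def)
  define f where "f i = cmod (a i) * exp (- lam i * (1 / real m))" for i
  have sm: "summable f"
    unfolding f_def using m by (intro abs_summable_of_L_freq_0[OF freq L a]) simp
  define b where "b J = (\<lambda>i. a i - (\<Sum>n<J. a n * monomial n i))" for J
  have b: "b J i = (if i < J then 0 else a i)" for J i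
    by (auto simp: b_def monomial_def if_distrib[of "\<lambda>x. a _ * x"] cong: if_cong)
  have sums: "(\<lambda>i. cmod (b J i) * exp (- lam i * (1 / real m))) sums (suminf f - (\<Sum>i<J. f i))" for J
  proof -
    have "(\<lambda>i. f i - (if i \<in> {..<J} then f i else 0)) sums (suminf f - (\<Sum>i\<in>{..<J}. f i))"
      by (intro sums_diff summable_sums[OF sm] sums_If_finite_set) simp
    also have "(\<lambda>i. f i - (if i \<in> {..<J} then f i else 0)) = (\<lambda>i. cmod (b J i) * exp (- lam i * (1 / real m)))"
      by (auto simp: b f_def)
    finally show ?thesis .
  qed
  have b_in: "b J \<in> carrier (D_infty_plus lam)" for J
    unfolding b_def
    by (intro D_infty_plus_diff_closed a D_infty_plus_sum_closed D_infty_plus_smult_closed monomial_in_carrier lam) simp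
  have "D_norm lam m (b J) \<le> suminf f - (\<Sum>i<J. f i)" for J
    using D_norm_le_suminf[where lam=lam and k=m, OF lam sums_summable[OF sums]] sums_unique[OF sums] by metis
  then have "norm (D_norm lam m (b J)) \<le> suminf f - (\<Sum>i<J. f i)" for J
    unfolding real_norm_def abs_of_nonneg[OF D_norm_nonneg[OF b_in m]] .
  moreover have "(\<lambda>J. suminf f - (\<Sum>i<J. f i)) \<longlonglongrightarrow> 0"
    using tendsto_diff[OF tendsto_const summable_LIMSEQ[OF sm], of "suminf f"] by simp
  ultimately have "(\<lambda>J. D_norm lam m (b J)) \<longlonglongrightarrow> 0"
    by (rule Lim_null_comparison[OF always_eventually, OF allI])
  then show ?thesis by (simp only: b_def)
qed

text \<open>The monomial expansion is a nuclear representation: from \<open>\<parallel>\<cdot>\<parallel>\<^sub>4\<^sub>m\<close> to \<open>\<parallel>\<cdot>\<parallel>\<^sub>m\<close>, with \<open>\<sigma> = 1/(2m)\<close>, the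
  norms of its terms are at most \<open>exp(\<lambda>\<^sub>n \<sigma>) exp(-\<lambda>\<^sub>n/m) = exp(-\<lambda>\<^sub>n \<sigma>)\<close>.\<close>
lemma nuclear_of_L_freq_0:
  assumes freq: "frequency lam" and L: "L_freq lam = 0"
  shows "nuclear_space (D_infty_plus lam) (D_norms lam)"
  unfolding nuclear_space_def
proof (intro conjI complex_vector_space_D_infty_plus directed_D_norms ballI)
  let ?E = "D_infty_plus lam"
  have lam: "0 \<le> lam n" for n using freq by (simp add: frequency_def)
  have mono_in: "monomial n \<in> carrier ?E" for n by (rule monomial_in_carrier[OF lam])
  fix q assume "q \<in> D_norms lam"
  then obtain m where m: "1 \<le> m" and q: "q = D_norm lam m" by (auto simp: D_norms_def)
  (* Any k > 2m would do: the coefficient bound needs 1/k < sigma, and sigma = 1/(2m) halves 1/m. *)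
  define k where "k = 4 * m"
  have k: "1 \<le> k" "m \<le> k" using m by (auto simp: k_def)
  define \<sigma> where "\<sigma> = 1 / (2 * real m)"
  have \<sigma>: "1 / real k < \<sigma>" "0 < \<sigma>" using m by (auto simp: k_def \<sigma>_def field_simps)
  define p where "p = D_norm lam k"
  have sem: "seminorm ?E p" unfolding p_def by (rule seminorm_D_norm[OF k(1)])
  have coeff: "cmod (a n) \<le> exp (lam n * \<sigma>) * p a" if "a \<in> carrier ?E" for a n
    unfolding p_def by (rule cauchy_coefficient_bound[OF freq L that k(1) \<sigma>(1)])
  have dual: "(\<lambda>a. a n) \<in> dual_space ?E p" for n
    unfolding dual_space_def using coeff[of _ n] by (auto simp: dirichlet_simps)
  have dual0: "0 \<le> dual_norm ?E p (\<lambda>a. a n)" for n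
    by (rule dual_norm_nonneg[OF complex_vector_space_D_infty_plus sem dual mono_in])
       (simp add: p_def D_norm_monomial_pos[OF freq k(1)])
  have dual_le: "dual_norm ?E p (\<lambda>a. a n) \<le> exp (lam n * \<sigma>)" for n
    unfolding dual_norm_def
  proof (rule cSUP_least)
    have "(\<lambda>n. 0) \<in> {x \<in> carrier ?E. p x \<le> 1}"
      using D_norm_eq_0_iff[OF freq k(1) D_infty_plus_zero] by (simp add: p_def D_infty_plus_zero)
    then show "{x \<in> carrier ?E. p x \<le> 1} \<noteq> {}" by blast
    fix a assume a: "a \<in> {x \<in> carrier ?E. p x \<le> 1}"
    then have "cmod (a n) \<le> exp (lam n * \<sigma>) * p a" using coeff by simp
    also have "\<dots> \<le> exp (lam n * \<sigma>) * 1" using a by (intro mult_left_mono) auto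
    finally show "cmod (a n) \<le> exp (lam n * \<sigma>)" by simp
  qed
  have "nuclear_operator (local_space ?E p) (local_norm p) (local_space ?E q) (local_norm q) (canonical_map ?E q)"
    unfolding p_def q nuclear_canonical_map_iff[OF complex_vector_space_D_infty_plus
        seminorm_kernel_D_norm[OF freq k(1)] seminorm_kernel_D_norm[OF freq m]]
    unfolding p_def[symmetric] q[symmetric]
  proof (intro exI[of _ "\<lambda>n a. a n"] exI[of _ monomial] conjI allI ballI dual mono_in)
    show "summable (\<lambda>n. dual_norm ?E p (\<lambda>a. a n) * q (monomial n))"
    proof (rule summable_comparison_test')
      show "summable (\<lambda>n. exp (- lam n * \<sigma>))" by (rule summable_exp_of_L_freq_0[OF freq L \<sigma>(2)])
      fix n
      have q0: "0 \<le> q (monomial n)" unfolding q by (rule D_norm_nonneg[OF mono_in m])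
      have "norm (dual_norm ?E p (\<lambda>a. a n) * q (monomial n)) = dual_norm ?E p (\<lambda>a. a n) * q (monomial n)"
        using q0 dual0 by simp
      also have "\<dots> \<le> exp (lam n * \<sigma>) * exp (- lam n * (1 / real m))"
        using q0 dual_le D_norm_monomial_le[where lam=lam and k=m and n=n, OF lam] unfolding q by (intro mult_mono) auto
      also have "\<dots> = exp (- lam n * \<sigma>)"
        unfolding exp_add[symmetric] \<sigma>_def using m by (simp add: field_simps)
      finally show "norm (dual_norm ?E p (\<lambda>a. a n) * q (monomial n)) \<le> exp (- lam n * \<sigma>)" .
    qed
    fix a assume a: "a \<in> carrier ?E"
    have am: "(\<lambda>i. a n * monomial n i) \<in> carrier ?E" for n by (intro D_infty_plus_smult_closed mono_in)
    have "a \<ominus>\<^bsub>?E\<^esub> (\<Oplus>\<^bsub>?E\<^esub>n\<in>{..<J}. a n \<odot>\<^bsub>?E\<^esub> monomial n) = (\<lambda>i. a i - (\<Sum>n<J. a n * monomial n i))" for J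
      using am D_infty_plus_sum_closed[of "{..<J}" "\<lambda>n i. a n * monomial n i"]
      by (simp add: D_infty_plus_finsum dirichlet_simps(3) D_infty_plus_diff a)
    then show "(\<lambda>J. q (a \<ominus>\<^bsub>?E\<^esub> (\<Oplus>\<^bsub>?E\<^esub>n\<in>{..<J}. a n \<odot>\<^bsub>?E\<^esub> monomial n))) \<longlonglongrightarrow> 0"
      using monomial_expansion[OF freq L m a] by (simp add: q)
  qed
  then show "\<exists>p\<in>D_norms lam. \<exists>c>0. (\<forall>x\<in>carrier ?E. q x \<le> c * p x) \<and>
      nuclear_operator (local_space ?E p) (local_norm p) (local_space ?E q) (local_norm q) (canonical_map ?E q)"
    using k D_norm_mono[OF _ m k(2)] by (intro bexI[of _ p] exI[of _ 1]) (auto simp: q p_def D_norms_def)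
qed

text \<open>A Cauchy filter is followed by a sequence \<open>X\<close> of points in smaller and smaller members. The
  coefficients of \<open>X\<close> converge, and the coefficient bound passes to the limit. It loses a factor
  \<open>exp(2\<lambda>\<^sub>n/(j+1))\<close>, which the summable weights \<open>exp(-\<sigma>\<lambda>\<^sub>n)\<close> absorb as soon as \<open>j\<close> is large compared with
  \<open>1/\<sigma>\<close>. So the limit coefficients define a series of the space, and the filter converges to it.\<close>
lemma complete_D_infty_plus:
  assumes freq: "frequency lam" and L: "L_freq lam = 0"
  shows "complete_space_on (D_infty_plus lam) (lc_topology (D_infty_plus lam) (D_norms lam))"
  unfolding complete_space_on_def
proof (intro allI impI)
  let ?E = "D_infty_plus lam"
  have lam: "0 \<le> lam n" for n using freq by (simp add: frequency_def)
  fix F assume F: "cauchy_filter_on ?E (lc_topology ?E (D_norms lam)) F"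
  then have F_bot: "F \<noteq> bot" and F_E: "\<forall>\<^sub>F x in F. x \<in> carrier ?E" by (auto simp: cauchy_filter_on_def)
  (* Members of F that are small in the norm with index j + 1; this avoids the meaningless index 0. *)
  define close where "close Q j \<longleftrightarrow> eventually Q F \<and>
      (\<forall>x y. Q x \<longrightarrow> Q y \<longrightarrow> x \<in> carrier ?E \<and> D_norm lam (Suc j) (\<lambda>n. x n - y n) < 1 / real (Suc j))" for Q j
  have "\<exists>Q. close Q j" for j
  proof -
    let ?U = "{y \<in> carrier ?E. D_norm lam (Suc j) (y \<ominus>\<^bsub>?E\<^esub> \<zero>\<^bsub>?E\<^esub>) < 1 / real (Suc j)}"
    have "openin (lc_topology ?E (D_norms lam)) ?U"
      by (intro openin_ball) (auto simp: D_norms_def)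
    moreover have "\<zero>\<^bsub>?E\<^esub> \<in> ?U"
      using D_norm_eq_0_iff[OF freq _ D_infty_plus_zero, of "Suc j"]
      by (simp add: D_infty_plus_diff dirichlet_simps D_infty_plus_zero)
    ultimately have "\<forall>\<^sub>F (x, y) in F \<times>\<^sub>F F. x \<ominus>\<^bsub>?E\<^esub> y \<in> ?U"
      using F unfolding cauchy_filter_on_def by blast
    then obtain Q where Q: "eventually Q F" "\<And>x y. Q x \<Longrightarrow> Q y \<Longrightarrow> x \<ominus>\<^bsub>?E\<^esub> y \<in> ?U"
      unfolding eventually_prod_same by auto
    have "close (\<lambda>x. Q x \<and> x \<in> carrier ?E) j"
      unfolding close_def
    proof (intro conjI eventually_conj Q F_E allI impI)
      fix x y assume x: "Q x \<and> x \<in> carrier ?E" and y: "Q y \<and> y \<in> carrier ?E"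
      then have "x \<ominus>\<^bsub>?E\<^esub> y \<in> ?U" by (intro Q) auto
      then show "D_norm lam (Suc j) (\<lambda>n. x n - y n) < 1 / real (Suc j)"
        using x y by (simp add: D_infty_plus_diff dirichlet_simps D_infty_plus_zero D_infty_plus_diff_closed)
      show "x \<in> carrier ?E" using x by simp
    qed
    then show ?thesis by blast
  qed
  then obtain Q where Q: "\<And>j. close (Q j) j" by metis
  (* Taking X j in the first j + 1 members at once makes X j close to every later term. *)
  have "\<exists>x. \<forall>i\<le>j. Q i x" for j
  proof -
    have "\<forall>\<^sub>F x in F. \<forall>i\<in>{..j}. Q i x"
      using Q by (intro eventually_ball_finite) (auto simp: close_def)
    from eventually_happens'[OF F_bot this] show ?thesis by auto
  qed
  then obtain X where X: "\<And>i j. i \<le> j \<Longrightarrow> Q i (X j)" by metis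
  have X_E: "X j \<in> carrier ?E" for j using Q X[of j j] unfolding close_def by blast
  have coeff: "cmod (x n - X i n) \<le> exp (lam n * (2 / real (Suc j))) / real (Suc j)"
    if "Q j x" "j \<le> i" for x n i j
  proof -
    have "x \<in> carrier ?E" "D_norm lam (Suc j) (\<lambda>n. x n - X i n) < 1 / real (Suc j)"
      using Q[of j] that X[OF that(2)] unfolding close_def by blast+
    moreover have "cmod (x n - X i n) \<le> exp (lam n * (2 / real (Suc j))) * D_norm lam (Suc j) (\<lambda>n. x n - X i n)"
      by (rule cauchy_coefficient_bound[OF freq L])
         (auto intro!: D_infty_plus_diff_closed X_E calculation divide_strict_right_mono)
    moreover have "exp (lam n * (2 / real (Suc j))) * D_norm lam (Suc j) (\<lambda>n. x n - X i n) \<le>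
        exp (lam n * (2 / real (Suc j))) * (1 / real (Suc j))"
      using calculation(2) by (intro mult_left_mono) auto
    ultimately show ?thesis by simp
  qed
  have "Cauchy (\<lambda>j. X j n)" for n
  proof (rule metric_CauchyI)
    fix e :: real assume e: "0 < e"
    obtain j where j: "2 * exp (lam n * 2) / e < real j" using reals_Archimedean2 by blast
    have "dist (X i n) (X i' n) < e" if "j \<le> i" "j \<le> i'" for i i'
    proof -
      have "dist (X i n) (X i' n) \<le> dist (X i n) (X j n) + dist (X i' n) (X j n)" by (rule dist_triangle2)
      also have "\<dots> \<le> exp (lam n * 2) / real (Suc j) + exp (lam n * 2) / real (Suc j)"
      proof -
        have "exp (lam n * (2 / real (Suc j))) / real (Suc j) \<le> exp (lam n * 2) / real (Suc j)"
          using lam[of n] by (intro divide_right_mono) (auto intro!: mult_left_mono simp: field_simps)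
        then show ?thesis
          using coeff[OF X[OF that(1)], of j n] coeff[OF X[OF that(2)], of j n]
          unfolding dist_norm by (intro add_mono) simp_all
      qed
      also have "\<dots> = 2 * exp (lam n * 2) / real (Suc j)" by simp
      also have "\<dots> < e" using j e by (simp add: field_simps)
      finally show ?thesis .
    qed
    then show "\<exists>M. \<forall>i\<ge>M. \<forall>i'\<ge>M. dist (X i n) (X i' n) < e" by blast
  qed
  then have "\<exists>l. (\<lambda>j. X j n) \<longlonglongrightarrow> l" for n
    by (simp add: Cauchy_convergent_iff convergent_def)
  then obtain l where l: "\<And>n. (\<lambda>j. X j n) \<longlonglongrightarrow> l n" by metis
  have limit: "cmod (x n - l n) \<le> exp (lam n * (2 / real (Suc j))) / real (Suc j)" if "Q j x" for x n j
  proof (rule Lim_norm_ubound)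
    show "(\<lambda>i. x n - X i n) \<longlonglongrightarrow> x n - l n" by (intro tendsto_intros l)
    show "\<forall>\<^sub>F i in sequentially. cmod (x n - X i n) \<le> exp (lam n * (2 / real (Suc j))) / real (Suc j)"
      using coeff[OF that] by (intro eventually_sequentiallyI[of j])
  qed simp
  have weighted: "cmod (x n - l n) * exp (- lam n * \<sigma>) \<le> 1 / real (Suc j) * exp (- lam n * (\<sigma> / 2))"
    if "Q j x" "4 / \<sigma> \<le> real (Suc j)" "0 < \<sigma>" for x n j \<sigma>
  proof -
    have "2 / real (Suc j) \<le> \<sigma> / 2" using that by (simp add: field_simps)
    then have "exp (lam n * (2 / real (Suc j))) \<le> exp (lam n * (\<sigma> / 2))"
      using lam[of n] by (simp only: exp_le_cancel_iff mult_left_mono)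
    then have "cmod (x n - l n) \<le> exp (lam n * (\<sigma> / 2)) / real (Suc j)"
      by (intro order_trans[OF limit[OF that(1), of n]] divide_right_mono) simp_all
    then have "cmod (x n - l n) * exp (- lam n * \<sigma>) \<le> exp (lam n * (\<sigma> / 2)) / real (Suc j) * exp (- lam n * \<sigma>)"
      by (intro mult_right_mono) auto
    also have "\<dots> = 1 / real (Suc j) * exp (lam n * (\<sigma> / 2) + - lam n * \<sigma>)"
      by (simp only: exp_add) simp
    also have "lam n * (\<sigma> / 2) + - lam n * \<sigma> = - lam n * (\<sigma> / 2)" by (simp add: field_simps)
    finally show ?thesis .
  qed
  have diff_sm: "summable (\<lambda>n. cmod (x n - l n) * exp (- lam n * \<sigma>))"
    if "Q j x" "4 / \<sigma> \<le> real (Suc j)" "0 < \<sigma>" for x j \<sigma>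
  proof (rule summable_comparison_test')
    show "summable (\<lambda>n. 1 / real (Suc j) * exp (- lam n * (\<sigma> / 2)))"
      using that(3) by (intro summable_mult summable_exp_of_L_freq_0[OF freq L]) simp
    show "norm (cmod (x n - l n) * exp (- lam n * \<sigma>)) \<le> 1 / real (Suc j) * exp (- lam n * (\<sigma> / 2))" for n
      using weighted[OF that, of n] by simp
  qed
  have l_E: "l \<in> carrier ?E"
  proof (rule abs_summable_imp_carrier[OF lam])
    fix \<sigma> :: real assume \<sigma>: "0 < \<sigma>"
    obtain j where j: "4 / \<sigma> \<le> real (Suc j)"
    proof -
      obtain j where "4 / \<sigma> < real j" using reals_Archimedean2 by blast
      then show thesis by (intro that[of j]) simp
    qed
    have "summable (\<lambda>n. cmod (X j n) * exp (- lam n * \<sigma>) + cmod (X j n - l n) * exp (- lam n * \<sigma>))"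
      by (intro summable_add abs_summable_of_L_freq_0[OF freq L X_E \<sigma>] diff_sm[OF X[OF order_refl] j \<sigma>])
    then show "summable (\<lambda>n. cmod (l n) * exp (- lam n * \<sigma>))"
    proof (rule summable_comparison_test')
      fix n
      have "cmod (l n) \<le> cmod (X j n) + cmod (X j n - l n)"
        using norm_triangle_ineq4[of "X j n" "X j n - l n"] by simp
      then have "cmod (l n) * exp (- lam n * \<sigma>) \<le> (cmod (X j n) + cmod (X j n - l n)) * exp (- lam n * \<sigma>)"
        by (intro mult_right_mono) auto
      then show "norm (cmod (l n) * exp (- lam n * \<sigma>)) \<le>
          cmod (X j n) * exp (- lam n * \<sigma>) + cmod (X j n - l n) * exp (- lam n * \<sigma>)"
        by (simp add: distrib_right)
    qed
  qed
  have conv: "\<forall>\<^sub>F x in F. x \<in> carrier ?E \<and> D_norm lam m (x \<ominus>\<^bsub>?E\<^esub> l) < e" if m: "1 \<le> m" and e: "0 < e" for m e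
  proof -
    define S where "S = (\<Sum>n. exp (- lam n * (1 / real m / 2)))"
    have sm: "summable (\<lambda>n. exp (- lam n * (1 / real m / 2)))"
      using m by (intro summable_exp_of_L_freq_0[OF freq L]) simp
    have S: "0 \<le> S" unfolding S_def by (intro suminf_nonneg sm) simp
    obtain j where j: "max (4 / (1 / real m)) (S / e) < real j" using reals_Archimedean2 by blast
    then have j1: "4 / (1 / real m) \<le> real (Suc j)" and j2: "S / real (Suc j) < e"
      using e S by (auto simp: field_simps)
    have "eventually (Q j) F" using Q[of j] by (simp add: close_def)
    then show ?thesis
    proof eventually_elim
      case (elim x)
      have x: "x \<in> carrier ?E" using Q[of j] elim unfolding close_def by blast
      have m0: "0 < 1 / real m" using m by simp
      have "D_norm lam m (\<lambda>n. x n - l n) \<le> (\<Sum>n. cmod (x n - l n) * exp (- lam n * (1 / real m)))"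
        by (rule D_norm_le_suminf[where lam=lam, OF lam diff_sm[OF elim j1 m0]])
      also have "\<dots> \<le> (\<Sum>n. 1 / real (Suc j) * exp (- lam n * (1 / real m / 2)))"
        by (intro suminf_le weighted[OF elim j1 m0] diff_sm[OF elim j1 m0] summable_mult sm)
      also have "\<dots> = S / real (Suc j)"
        unfolding S_def by (subst suminf_mult[OF sm]) simp
      also have "\<dots> < e" by (rule j2)
      finally show ?case using x l_E by (simp add: D_infty_plus_diff)
    qed
  qed
  have "limitin (lc_topology ?E (D_norms lam)) (\<lambda>x. x) l F"
    unfolding limitin_def topspace_lc_topology
  proof (intro conjI l_E allI impI)
    fix U assume "openin (lc_topology ?E (D_norms lam)) U \<and> l \<in> U"
    then obtain p e where p: "p \<in> D_norms lam" "0 < e" "\<forall>y\<in>carrier ?E. p (y \<ominus>\<^bsub>?E\<^esub> l) < e \<longrightarrow> y \<in> U"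
      using openin_lc_topology_imp_ball[OF complex_vector_space_D_infty_plus directed_D_norms] by meson
    then obtain m where m: "1 \<le> m" "p = D_norm lam m" by (auto simp: D_norms_def)
    show "\<forall>\<^sub>F x in F. x \<in> U"
      using conv[OF m(1) p(2)] p(3) unfolding m(2) by (auto elim: eventually_mono)
  qed
  then show "\<exists>l. limitin (lc_topology ?E (D_norms lam)) (\<lambda>x. x) l F" by blast
qed

lemma frechet_D_infty_plus:
  assumes freq: "frequency lam" and L: "L_freq lam = 0"
  shows "frechet_space (D_infty_plus lam) (lc_topology (D_infty_plus lam) (D_norms lam))"
  unfolding frechet_space_def
proof (intro conjI complex_vector_space_D_infty_plus complete_D_infty_plus[OF assms]
    exI[of _ "D_norms lam"] ballI refl)
  have "D_norms lam = D_norm lam ` {1..}" by (auto simp: D_norms_def)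
  then show "countable (D_norms lam)" by simp
  show "seminorm (D_infty_plus lam) p" if "p \<in> D_norms lam" for p
    using that by (auto simp: D_norms_def seminorm_D_norm)
  show "Hausdorff_space (lc_topology (D_infty_plus lam) (D_norms lam))"
    by (rule Hausdorff_lc_topology[where p = "D_norm lam 1"])
       (auto simp: D_norms_def seminorm_D_norm seminorm_kernel_D_norm[OF freq] complex_vector_space_D_infty_plus)
qed

section \<open>The characterization\<close>

theorem theorem5p6:
  fixes lam :: "nat \<Rightarrow> real"
  assumes "frequency lam"
  shows "(nuclear_space (D_infty_plus lam) (D_norms lam) \<and>
          frechet_space (D_infty_plus lam) (lc_topology (D_infty_plus lam) (D_norms lam)))
         \<longleftrightarrow> L_freq lam = 0"
  using nuclear_imp_L_freq_eq_0 nuclear_of_L_freq_0 frechet_D_infty_plus assms by blast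

end
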